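(* Let $H$ be an infinite-dimensional complex separable Hilbert space. Then $\mathcal B(H)$ has the BCP, while $L_\infty[0,1]$ fails the BCP and is completely isometrically isomorphic to a completely $1$-complemented subspace of $\mathcal B(H)$. Hence the BCP does not pass to $1$-complemented subspaces, even to completely $1$-complemented subspaces in the operator space sense.
   Context: $\mathcal B(H)$ is the space of bounded linear operators on $H$ with the operator norm. $L_\infty[0,1]$ is the complex $L_\infty$ space for Lebesgue measure, with its natural operator space structure as a commutative $C^*$-algebra. For a linear map $u:E\to F$ between operator spaces, let $u_n:M_n(E)\to M_n(F)$ be the map applying $u$ entrywise; $u$ is completely contractive if $\|u_n\|\le 1$ for all $n$, and is a complete isometry if every $u_n$ is an isometry. $M_n(\mathcal B(H))$ is normed as $\mathcal B(H^n)$. A subspace $Y\subseteq\mathcal B(H)$ is completely $1$-complemented if there is a completely contractive linear projection from $\mathcal B(H)$ onto $Y$; a subspace is $1$-complemented if there is a norm-one linear projection onto it. A normed space $X$ has the ball-covering property (BCP) if its unit sphere $S_X=\{x:\|x\|=1\}$ can be covered by countably many closed (equivalently, open) balls, none of which contains the origin. *)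

theory Defs
  imports "HOL-Probability.Essential_Supremum"
begin

section \<open>Complex normed spaces and complex Hilbert spaces\<close>

class complex_vector = real_vector +
  fixes scaleC :: "complex \<Rightarrow> 'a \<Rightarrow> 'a" (infixr "*\<^sub>C" 75)
  assumes scaleC_add_right: "a *\<^sub>C (x + y) = a *\<^sub>C x + a *\<^sub>C y"
    and scaleC_add_left: "(a + b) *\<^sub>C x = a *\<^sub>C x + b *\<^sub>C x"
    and scaleC_scaleC: "a *\<^sub>C b *\<^sub>C x = (a * b) *\<^sub>C x"
    and scaleC_of_real: "complex_of_real r *\<^sub>C x = r *\<^sub>R x"

global_interpretation complex_vector:
  vector_space "scaleC :: complex \<Rightarrow> 'a \<Rightarrow> 'a :: complex_vector"
  defines csubspace = complex_vector.subspace
    and cspan = complex_vector.span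
proof
  fix x :: 'a
  show "1 *\<^sub>C x = x"
    using scaleC_of_real[of 1 x] by simp
qed (fact scaleC_add_right scaleC_add_left scaleC_scaleC)+

class complex_normed_vector = complex_vector + real_normed_vector +
  assumes norm_scaleC: "norm (a *\<^sub>C x) = cmod a * norm x"

text \<open>The inner product is linear in the second argument.  Positive definiteness follows from
  the last axiom, because \<open>norm\<close> is a norm and \<open>sqrt\<close> is negative on negative reals.\<close>

class complex_inner = complex_normed_vector +
  fixes cinner :: "'a \<Rightarrow> 'a \<Rightarrow> complex"
  assumes cinner_commute: "cinner x y = cnj (cinner y x)"
    and cinner_add_right: "cinner x (y + z) = cinner x y + cinner x z"
    and cinner_scaleC_right: "cinner x (a *\<^sub>C y) = a * cinner x y"
    and norm_eq_sqrt_cinner: "norm x = sqrt (Re (cinner x x))"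

class complex_hilbert = complex_inner + complete_space

definition clinear_on :: "'a::complex_vector set \<Rightarrow> ('a \<Rightarrow> 'b::complex_vector) \<Rightarrow> bool" where
  "clinear_on E f \<longleftrightarrow>
     (\<forall>x\<in>E. \<forall>y\<in>E. f (x + y) = f x + f y) \<and> (\<forall>a. \<forall>x\<in>E. f (a *\<^sub>C x) = a *\<^sub>C f x)"

section \<open>The ball-covering property\<close>

text \<open>The normed space is a linear subspace \<open>X\<close> of the ambient type, so the centres of
  the balls are required to lie in \<open>X\<close>.\<close>

definition ball_covering_property :: "'a::real_normed_vector set \<Rightarrow> bool" where
  "ball_covering_property X \<longleftrightarrow>
     (\<exists>\<B> :: ('a \<times> real) set. countable \<B> \<and>
        (\<forall>(c, r)\<in>\<B>. c \<in> X \<and> 0 < r \<and> 0 \<notin> cball c r) \<and>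
        X \<inter> sphere 0 1 \<subseteq> (\<Union>(c, r)\<in>\<B>. cball c r))"

section \<open>Bounded operators\<close>

instantiation blinfun :: (real_normed_vector, complex_normed_vector) complex_normed_vector
begin

lift_definition scaleC_blinfun :: "complex \<Rightarrow> 'a \<Rightarrow>\<^sub>L 'b \<Rightarrow> 'a \<Rightarrow>\<^sub>L 'b" is "\<lambda>a T x. a *\<^sub>C T x"
proof -
  fix a :: complex and T :: "'a \<Rightarrow> 'b"
  assume T: "bounded_linear T"
  have "bounded_linear ((*\<^sub>C) a :: 'b \<Rightarrow> 'b)"
  proof (rule bounded_linear_intro[where K = "cmod a"])
    fix r and x :: 'b
    have "a *\<^sub>C complex_of_real r *\<^sub>C x = complex_of_real r *\<^sub>C a *\<^sub>C x"
      by (simp only: scaleC_scaleC mult.commute)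
    then show "a *\<^sub>C (r *\<^sub>R x) = r *\<^sub>R (a *\<^sub>C x)"
      by (simp only: scaleC_of_real)
  qed (simp_all add: scaleC_add_right norm_scaleC mult.commute)
  from bounded_linear_compose[OF this T] show "bounded_linear (\<lambda>x. a *\<^sub>C T x)" .
qed

instance
proof
  fix a b :: complex and r :: real and S T :: "'a \<Rightarrow>\<^sub>L 'b"
  show "a *\<^sub>C (S + T) = a *\<^sub>C S + a *\<^sub>C T"
    by transfer (simp add: scaleC_add_right)
  show "(a + b) *\<^sub>C T = a *\<^sub>C T + b *\<^sub>C T"
    by transfer (simp add: scaleC_add_left)
  show "a *\<^sub>C b *\<^sub>C T = (a * b) *\<^sub>C T"
    by transfer (simp add: scaleC_scaleC)
  show "complex_of_real r *\<^sub>C T = r *\<^sub>R T"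
    by transfer (simp add: scaleC_of_real)
  have le: "norm (a *\<^sub>C T) \<le> cmod a * norm T" for a :: complex and T :: "'a \<Rightarrow>\<^sub>L 'b"
  proof (rule norm_blinfun_bound)
    fix x
    have "norm (blinfun_apply (a *\<^sub>C T) x) = cmod a * norm (blinfun_apply T x)"
      by (simp add: scaleC_blinfun.rep_eq norm_scaleC)
    also have "\<dots> \<le> cmod a * (norm T * norm x)"
      by (intro mult_left_mono norm_blinfun) simp
    finally show "norm (blinfun_apply (a *\<^sub>C T) x) \<le> cmod a * norm T * norm x"
      by (simp add: mult.assoc)
  qed simp
  show "norm (a *\<^sub>C T) = cmod a * norm T"
  proof (cases "a = 0")
    case True
    then show ?thesis using le[of a T] by simp
  next
    case False
    have "inverse a *\<^sub>C a *\<^sub>C T = T"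
      using False by transfer (simp add: scaleC_scaleC)
    with le[of "inverse a" "a *\<^sub>C T"] have "norm T \<le> norm (a *\<^sub>C T) / cmod a"
      by (simp add: norm_inverse divide_inverse mult.commute)
    with False have "cmod a * norm T \<le> norm (a *\<^sub>C T)"
      by (simp add: field_simps)
    with le[of a T] show ?thesis by simp
  qed
qed

end

text \<open>\<open>'h \<Rightarrow>\<^sub>L 'h\<close> consists of the real-linear bounded maps; \<open>\<B>(H)\<close> is the subspace of the
  complex-linear ones.  The norm of \<open>'h \<Rightarrow>\<^sub>L 'h\<close> is the operator norm.\<close>

definition bounded_operators :: "('h::complex_normed_vector \<Rightarrow>\<^sub>L 'h) set" where
  "bounded_operators = {T. clinear_on UNIV (blinfun_apply T)}"

section \<open>The space \<open>L\<^sub>\<infinity>[0,1]\<close>\<close>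

abbreviation unit_measure :: "real measure" where
  "unit_measure \<equiv> lebesgue_on {0..1}"

definition ess_norm :: "(real \<Rightarrow> complex) \<Rightarrow> ereal" where
  "ess_norm f = esssup unit_measure (\<lambda>t. ereal (cmod (f t)))"

definition ess_bounded :: "(real \<Rightarrow> complex) \<Rightarrow> bool" where
  "ess_bounded f \<longleftrightarrow> f \<in> borel_measurable unit_measure \<and> ess_norm f < \<infinity>"

lemma ess_bounded_iff:
  "ess_bounded f \<longleftrightarrow>
     f \<in> borel_measurable unit_measure \<and> (\<exists>K. AE t in unit_measure. cmod (f t) \<le> K)"
proof (intro iffI conjI; (elim conjE)?)
  assume f: "ess_bounded f"
  then show "f \<in> borel_measurable unit_measure"
    by (simp add: ess_bounded_def)
  have AE: "AE t in unit_measure. ereal (cmod (f t)) \<le> ess_norm f"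
    unfolding ess_norm_def by (rule esssup_AE)
  show "\<exists>K. AE t in unit_measure. cmod (f t) \<le> K"
  proof (cases "ess_norm f")
    case (real r)
    with AE show ?thesis by auto
  next
    case MInf
    with AE show ?thesis by (intro exI[of _ 0]) auto
  qed (use f in \<open>simp add: ess_bounded_def\<close>)
next
  assume f: "f \<in> borel_measurable unit_measure" "\<exists>K. AE t in unit_measure. cmod (f t) \<le> K"
  then obtain K where "AE t in unit_measure. ereal (cmod (f t)) \<le> ereal K"
    by auto
  with f(1) have "ess_norm f \<le> ereal K"
    unfolding ess_norm_def by (intro esssup_I) measurable
  with f(1) show "ess_bounded f"
    by (auto simp: ess_bounded_def)
qed

lemma ess_bounded_0: "ess_bounded (\<lambda>_. 0)"
  by (auto simp: ess_bounded_iff)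

lemma ess_bounded_add:
  assumes "ess_bounded f" "ess_bounded g"
  shows "ess_bounded (\<lambda>t. f t + g t)"
proof -
  from assms obtain K L where "AE t in unit_measure. cmod (f t) \<le> K"
    "AE t in unit_measure. cmod (g t) \<le> L"
    by (auto simp: ess_bounded_iff)
  then have "AE t in unit_measure. cmod (f t + g t) \<le> K + L"
    by eventually_elim (meson add_mono norm_triangle_ineq order_trans)
  with assms show ?thesis
    by (auto simp: ess_bounded_iff)
qed

lemma ess_bounded_cmult:
  assumes "ess_bounded f"
  shows "ess_bounded (\<lambda>t. a * f t)"
proof -
  from assms obtain K where "AE t in unit_measure. cmod (f t) \<le> K"
    by (auto simp: ess_bounded_iff)
  then have "AE t in unit_measure. cmod (a * f t) \<le> cmod a * K"
    by eventually_elim (simp add: norm_mult mult_left_mono)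
  with assms show ?thesis
    by (auto simp: ess_bounded_iff)
qed

lemma ess_bounded_minus: "ess_bounded f \<Longrightarrow> ess_bounded (\<lambda>t. - f t)"
  using ess_bounded_cmult[of f "-1"] by simp

lemma ess_bounded_diff: "ess_bounded f \<Longrightarrow> ess_bounded g \<Longrightarrow> ess_bounded (\<lambda>t. f t - g t)"
  using ess_bounded_add[of f "\<lambda>t. - g t"] by (simp add: ess_bounded_minus)

lemma ess_norm_nonneg: "0 \<le> ess_norm f"
proof (cases "(\<lambda>t. ereal (cmod (f t))) \<in> borel_measurable unit_measure")
  case True
  have "emeasure unit_measure (space unit_measure) \<noteq> 0"
    by (simp add: emeasure_restrict_space)
  then have "esssup unit_measure (\<lambda>_. 0::ereal) = 0"
    by (rule esssup_const)
  moreover have "esssup unit_measure (\<lambda>_. 0::ereal) \<le> ess_norm f"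
    unfolding ess_norm_def by (rule esssup_mono) auto
  ultimately show ?thesis by simp
qed (simp add: ess_norm_def esssup_non_measurable)

lemma ess_norm_cong:
  assumes "ess_bounded f" "ess_bounded g" "AE t in unit_measure. f t = g t"
  shows "ess_norm f = ess_norm g"
  unfolding ess_norm_def
proof (rule esssup_AE_cong)
  show "AE t in unit_measure. ereal (cmod (f t)) = ereal (cmod (g t))"
    using assms(3) by eventually_elim simp
qed (use assms in \<open>auto simp: ess_bounded_def\<close>)

lemma ess_norm_real: "ess_bounded f \<Longrightarrow> ereal (real_of_ereal (ess_norm f)) = ess_norm f"
  using ess_norm_nonneg[of f] by (cases "ess_norm f") (auto simp: ess_bounded_def)

definition ess_eq :: "(real \<Rightarrow> complex) \<Rightarrow> (real \<Rightarrow> complex) \<Rightarrow> bool" where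
  "ess_eq f g \<longleftrightarrow> ess_bounded f \<and> ess_bounded g \<and> (AE t in unit_measure. f t = g t)"

quotient_type linf = "real \<Rightarrow> complex" / partial: ess_eq
proof (rule part_equivpI)
  show "\<exists>f. ess_eq f f"
    using ess_bounded_0 by (auto simp: ess_eq_def)
  show "symp ess_eq"
    by (auto intro!: sympI simp: ess_eq_def elim: eventually_mono)
  show "transp ess_eq"
  proof (rule transpI)
    fix f g h
    assume "ess_eq f g" "ess_eq g h"
    moreover from this have "AE t in unit_measure. f t = h t"
      unfolding ess_eq_def by (auto elim: eventually_elim2)
    ultimately show "ess_eq f h"
      by (simp add: ess_eq_def)
  qed
qed

instantiation linf :: complex_normed_vector
begin

lift_definition zero_linf :: linf is "\<lambda>_. 0"
  by (simp add: ess_eq_def ess_bounded_0)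

lift_definition plus_linf :: "linf \<Rightarrow> linf \<Rightarrow> linf" is "\<lambda>f g t. f t + g t"
  unfolding ess_eq_def by (auto intro: ess_bounded_add elim: eventually_elim2)

lift_definition minus_linf :: "linf \<Rightarrow> linf \<Rightarrow> linf" is "\<lambda>f g t. f t - g t"
  unfolding ess_eq_def by (auto intro: ess_bounded_diff elim: eventually_elim2)

lift_definition uminus_linf :: "linf \<Rightarrow> linf" is "\<lambda>f t. - f t"
  unfolding ess_eq_def by (auto intro: ess_bounded_minus elim: eventually_mono)

lift_definition scaleC_linf :: "complex \<Rightarrow> linf \<Rightarrow> linf" is "\<lambda>a f t. a * f t"
  unfolding ess_eq_def by (auto intro: ess_bounded_cmult elim: eventually_mono)

definition scaleR_linf :: "real \<Rightarrow> linf \<Rightarrow> linf" where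
  "scaleR_linf r x = complex_of_real r *\<^sub>C x"

lift_definition norm_linf :: "linf \<Rightarrow> real" is "\<lambda>f. real_of_ereal (ess_norm f)"
  unfolding ess_eq_def by (metis ess_norm_cong)

definition sgn_linf :: "linf \<Rightarrow> linf" where
  "sgn_linf x = inverse (norm x) *\<^sub>R x"

definition dist_linf :: "linf \<Rightarrow> linf \<Rightarrow> real" where
  "dist_linf x y = norm (x - y)"

definition uniformity_linf :: "(linf \<times> linf) filter" where
  "uniformity_linf = (INF e\<in>{0 <..}. principal {(x, y). dist x y < e})"

definition open_linf :: "linf set \<Rightarrow> bool" where
  "open_linf S \<longleftrightarrow> (\<forall>x\<in>S. \<forall>\<^sub>F (x', y) in uniformity. x' = x \<longrightarrow> y \<in> S)"

instance
proof
  fix a b :: complex and r s :: real and x y z :: linf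
  show "x + y + z = x + (y + z)"
    by transfer (auto simp: ess_eq_def algebra_simps intro!: ess_bounded_add)
  show "x + y = y + x"
    by transfer (auto simp: ess_eq_def algebra_simps intro!: ess_bounded_add)
  show "0 + x = x"
    by transfer (auto simp: ess_eq_def)
  show "- x + x = 0"
    by transfer (auto simp: ess_eq_def ess_bounded_0)
  show "x - y = x + - y"
    by transfer (auto simp: ess_eq_def intro: ess_bounded_diff)
  show C1: "a *\<^sub>C (x + y) = a *\<^sub>C x + a *\<^sub>C y" for a
    by transfer (auto simp: ess_eq_def algebra_simps intro!: ess_bounded_add ess_bounded_cmult)
  show C2: "(a + b) *\<^sub>C x = a *\<^sub>C x + b *\<^sub>C x" for a b
    by transfer (auto simp: ess_eq_def algebra_simps intro!: ess_bounded_add ess_bounded_cmult)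
  show C3: "a *\<^sub>C b *\<^sub>C x = (a * b) *\<^sub>C x" for a b
    by transfer (auto simp: ess_eq_def mult.assoc intro!: ess_bounded_cmult)
  show "complex_of_real r *\<^sub>C x = r *\<^sub>R x"
    by (simp add: scaleR_linf_def)
  show "r *\<^sub>R (x + y) = r *\<^sub>R x + r *\<^sub>R y" "(r + s) *\<^sub>R x = r *\<^sub>R x + s *\<^sub>R x"
    "r *\<^sub>R s *\<^sub>R x = (r * s) *\<^sub>R x"
    by (simp_all add: scaleR_linf_def C1 C2 C3)
  show "1 *\<^sub>R x = x"
    unfolding scaleR_linf_def by transfer (auto simp: ess_eq_def)
  show "sgn x = inverse (norm x) *\<^sub>R x" "dist x y = norm (x - y)"
    by (simp_all add: sgn_linf_def dist_linf_def)
  show "norm x = 0 \<longleftrightarrow> x = 0"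
  proof transfer
    fix f assume "ess_eq f f"
    then have f: "ess_bounded f" by (simp add: ess_eq_def)
    have AE: "AE t in unit_measure. ereal (cmod (f t)) \<le> ess_norm f"
      unfolding ess_norm_def by (rule esssup_AE)
    have z: "ess_norm (\<lambda>_. 0) = 0"
      unfolding ess_norm_def by (simp add: esssup_const emeasure_restrict_space)
    show "real_of_ereal (ess_norm f) = 0 \<longleftrightarrow> ess_eq f (\<lambda>_. 0)"
    proof
      assume "real_of_ereal (ess_norm f) = 0"
      with ess_norm_real[OF f] have "ess_norm f = 0" by (metis zero_ereal_def)
      with AE show "ess_eq f (\<lambda>_. 0)"
        using f ess_bounded_0 by (auto simp: ess_eq_def elim: eventually_mono)
    next
      assume "ess_eq f (\<lambda>_. 0)"
      then show "real_of_ereal (ess_norm f) = 0"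
        using ess_norm_cong[of f "\<lambda>_. 0"] z by (simp add: ess_eq_def)
    qed
  qed
  show "norm (x + y) \<le> norm x + norm y"
  proof transfer
    fix f g assume "ess_eq f f" "ess_eq g g"
    then have fg: "ess_bounded f" "ess_bounded g" by (simp_all add: ess_eq_def)
    then have [measurable]: "f \<in> borel_measurable unit_measure" "g \<in> borel_measurable unit_measure"
      by (simp_all add: ess_bounded_def)
    have "ess_norm (\<lambda>t. f t + g t)
        \<le> esssup unit_measure (\<lambda>t. ereal (cmod (f t)) + ereal (cmod (g t)))"
      unfolding ess_norm_def by (rule esssup_mono) (simp_all add: norm_triangle_ineq)
    also have "\<dots> \<le> ess_norm f + ess_norm g"
      unfolding ess_norm_def by (rule esssup_add)
    finally have "ereal (real_of_ereal (ess_norm (\<lambda>t. f t + g t)))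
        \<le> ereal (real_of_ereal (ess_norm f)) + ereal (real_of_ereal (ess_norm g))"
      using fg by (simp only: ess_norm_real ess_bounded_add)
    then show "real_of_ereal (ess_norm (\<lambda>t. f t + g t))
        \<le> real_of_ereal (ess_norm f) + real_of_ereal (ess_norm g)"
      by simp
  qed
  show nC: "norm (a *\<^sub>C x) = cmod a * norm x" for a
  proof transfer
    fix a f assume "ess_eq f f"
    show "real_of_ereal (ess_norm (\<lambda>t. a * f t)) = cmod a * real_of_ereal (ess_norm f)"
    proof (cases "a = 0")
      case True
      then show ?thesis
        unfolding ess_norm_def by (simp add: esssup_const emeasure_restrict_space)
    next
      case False
      then show ?thesis
        unfolding ess_norm_def
        using esssup_cmult[of "cmod a" unit_measure "\<lambda>t. ereal (cmod (f t))"]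
        by (simp add: norm_mult)
    qed
  qed
  show "norm (r *\<^sub>R x) = \<bar>r\<bar> * norm x"
    by (simp add: scaleR_linf_def nC)
qed (simp_all add: uniformity_linf_def open_linf_def)

end

section \<open>Operator space structures\<close>

text \<open>A matrix over \<open>'a\<close> of size \<open>n\<close> is a function \<open>nat \<Rightarrow> nat \<Rightarrow> 'a\<close> of which only the entries
  with indices below \<open>n\<close> matter; an operator space structure is given by the norms on the
  spaces \<open>M\<^sub>n\<close>.\<close>

type_synonym 'a matrix_norms = "nat \<Rightarrow> (nat \<Rightarrow> nat \<Rightarrow> 'a) \<Rightarrow> real"

text \<open>The norm of the operator on the Hilbert sum \<open>H\<^sup>n\<close> with matrix \<open>T\<close>.\<close>

definition matrix_op_norm :: "nat \<Rightarrow> (nat \<Rightarrow> nat \<Rightarrow> 'h::real_normed_vector \<Rightarrow> 'h) \<Rightarrow> real" where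
  "matrix_op_norm n T =
     Sup {L2_set (\<lambda>i. norm (\<Sum>j<n. T i j (x j))) {..<n} | x.
            L2_set (\<lambda>j. norm (x j)) {..<n} \<le> 1}"

definition operator_matrix_norms :: "('h::complex_hilbert \<Rightarrow>\<^sub>L 'h) matrix_norms" where
  "operator_matrix_norms n T = matrix_op_norm n (\<lambda>i j. blinfun_apply (T i j))"

text \<open>\<open>M\<^sub>n(L\<^sub>\<infinity>) = L\<^sub>\<infinity>([0,1]; M\<^sub>n)\<close>, where \<open>M\<^sub>n\<close> carries the norm of operators on \<open>\<complex>\<^sup>n\<close>; this is
  the unique C*-norm on \<open>M\<^sub>n(L\<^sub>\<infinity>)\<close>.\<close>

definition linf_matrix_norms :: "linf matrix_norms" where
  "linf_matrix_norms n F =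
     real_of_ereal (esssup unit_measure
       (\<lambda>t. ereal (matrix_op_norm n (\<lambda>i j z. rep_linf (F i j) t * z))))"

definition completely_contractive ::
  "'a set \<Rightarrow> 'a matrix_norms \<Rightarrow> 'b matrix_norms \<Rightarrow> ('a \<Rightarrow> 'b) \<Rightarrow> bool" where
  "completely_contractive E N N' u \<longleftrightarrow>
     (\<forall>n\<ge>1. \<forall>A. (\<forall>i<n. \<forall>j<n. A i j \<in> E) \<longrightarrow> N' n (\<lambda>i j. u (A i j)) \<le> N n A)"

definition complete_isometry ::
  "'a set \<Rightarrow> 'a matrix_norms \<Rightarrow> 'b matrix_norms \<Rightarrow> ('a \<Rightarrow> 'b) \<Rightarrow> bool" where
  "complete_isometry E N N' u \<longleftrightarrow>
     (\<forall>n\<ge>1. \<forall>A. (\<forall>i<n. \<forall>j<n. A i j \<in> E) \<longrightarrow> N' n (\<lambda>i j. u (A i j)) = N n A)"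

definition completely_isometrically_isomorphic ::
  "'a::complex_vector set \<Rightarrow> 'a matrix_norms \<Rightarrow> 'b::complex_vector set \<Rightarrow> 'b matrix_norms \<Rightarrow> bool"
  where
  "completely_isometrically_isomorphic E N F N' \<longleftrightarrow>
     (\<exists>u. clinear_on E u \<and> bij_betw u E F \<and> complete_isometry E N N' u)"

section \<open>Complemented subspaces\<close>

definition linear_projection_onto :: "'a::complex_vector set \<Rightarrow> 'a set \<Rightarrow> ('a \<Rightarrow> 'a) \<Rightarrow> bool" where
  "linear_projection_onto X Y P \<longleftrightarrow> clinear_on X P \<and> P ` X = Y \<and> (\<forall>x\<in>X. P (P x) = P x)"

definition has_op_norm_on :: "'a::real_normed_vector set \<Rightarrow> ('a \<Rightarrow> 'b::real_normed_vector) \<Rightarrow> real \<Rightarrow> bool"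
  where
  "has_op_norm_on X f C \<longleftrightarrow>
     0 \<le> C \<and> (\<forall>x\<in>X. norm (f x) \<le> C * norm x) \<and>
     (\<forall>K\<ge>0. (\<forall>x\<in>X. norm (f x) \<le> K * norm x) \<longrightarrow> C \<le> K)"

definition one_complemented :: "'a::complex_normed_vector set \<Rightarrow> 'a set \<Rightarrow> bool" where
  "one_complemented X Y \<longleftrightarrow> csubspace Y \<and> Y \<subseteq> X \<and>
     (\<exists>P. linear_projection_onto X Y P \<and> has_op_norm_on X P 1)"

definition completely_one_complemented ::
  "'a::complex_vector set \<Rightarrow> 'a matrix_norms \<Rightarrow> 'a set \<Rightarrow> bool" where
  "completely_one_complemented X N Y \<longleftrightarrow> csubspace Y \<and> Y \<subseteq> X \<and>
     (\<exists>P. linear_projection_onto X Y P \<and> completely_contractive X N N P)"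

end

theory Submission
  imports Defs
begin

text \<open>
  For the ball-covering property of \<open>\<B>(H)\<close>: if \<open>\<parallel>T\<parallel> = 1\<close> is almost attained at the unit vector
  \<open>x\<close> and \<open>y = T x / \<parallel>T x\<parallel>\<close>, then twice the rank-one operator \<open>R = \<langle>x, -\<rangle> y\<close>
  has norm 2 while \<open>T - 2R\<close> has norm at most 3/2; by separability countably many such centres suffice.

  For its failure in \<open>L\<^sub>\<infinity>\<close>: given balls with centres \<open>c\<^sub>n\<close> and radii
  \<open>r\<^sub>n < \<parallel>c\<^sub>n\<parallel>\<close>, choose disjoint non-null sets on which \<open>\<bar>c\<^sub>n\<bar> > r\<^sub>n\<close>
  and let \<open>f\<close> be \<open>- c\<^sub>n / \<bar>c\<^sub>n\<bar>\<close> there and 1 elsewhere; \<open>f\<close> lies in no ball.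

  The embedding \<open>\<iota>\<close> sends \<open>f\<close> to the operator that is diagonal with respect to an orthonormal
  sequence indexed by the cells of a sequence of finer and finer partitions of [0,1], the entries being
  the averages of \<open>f\<close> over the cells.  Conversely, the diagonal entries of an operator \<open>T\<close>
  define a step function for each partition; a weak* limit of these along a free ultrafilter, which exists
  by the Radon-Nikodym theorem, is \<open>E T \<in> L\<^sub>\<infinity>\<close>.  Both maps are completely contractive and
  \<open>E \<circ> \<iota> = id\<close>, so \<open>\<iota>\<close> is a complete isometry and \<open>\<iota> \<circ> E\<close> is a
  completely contractive projection onto its range.
\<close>

section \<open>Limits along an ultrafilter\<close>

definition is_ultrafilter :: "'a filter \<Rightarrow> bool" where
  "is_ultrafilter U \<longleftrightarrow> U \<noteq> bot \<and> (\<forall>P. eventually P U \<or> eventually (\<lambda>x. \<not> P x) U)"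

text \<open>Zorn's lemma for the proper filters below \<open>F\<close>: smaller filters are finer,
  so the minimal ones are the ultrafilters.\<close>

lemma ultrafilter_refinement:
  fixes F :: "'a filter"
  assumes "F \<noteq> bot"
  obtains U where "is_ultrafilter U" "U \<le> F"
proof -
  define \<F> where "\<F> = {G :: 'a filter. G \<noteq> bot \<and> G \<le> F}"
  have "\<exists>M\<in>\<F>. \<forall>G\<in>\<F>. G \<le> M \<longrightarrow> G = M"
  proof (rule predicate_Zorn)
    show "partial_order_on \<F> (relation_of (\<ge>) \<F>)"
      by (rule partial_order_on_relation_ofI) auto
    fix C assume C: "C \<in> Chains (relation_of (\<ge>) \<F>)"
    then have sub: "C \<subseteq> \<F>" and lin: "\<And>G H. G \<in> C \<Longrightarrow> H \<in> C \<Longrightarrow> G \<le> H \<or> H \<le> G"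
      by (auto simp: Chains_def relation_of_def)
    show "\<exists>u\<in>\<F>. \<forall>a\<in>C. u \<le> a"
    proof (cases "C = {}")
      case True
      then show ?thesis using assms by (auto simp: \<F>_def)
    next
      case False
      \<comment> \<open>An infimum of filters is proper once all finite subinfima are, and in a
        chain a finite infimum is one of the members.\<close>
      have min: "\<exists>m\<in>X. Inf X = m" if "finite X" "X \<noteq> {}" "X \<subseteq> C" for X
        using that
      proof (induction X rule: finite_ne_induct)
        case (insert x X)
        then obtain m where m: "m \<in> X" "Inf X = m" by auto
        with insert.prems have "x \<le> m \<or> m \<le> x" by (intro lin) auto
        then have "inf x m = x \<or> inf x m = m" by (auto simp: inf.absorb1 inf.absorb2)
        with m show ?case by auto
      qed simp
      have "Inf C \<noteq> bot"
      proof (rule Inf_filter_not_bot)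
        fix X assume X: "X \<subseteq> C" "finite X"
        show "Inf X \<noteq> bot"
        proof (cases "X = {}")
          case True
          have "(top :: 'a filter) \<noteq> bot" using assms by (metis bot.extremum_uniqueI top_greatest)
          with True show ?thesis by simp
        next
          case False
          with min[OF X(2) False X(1)] X sub show ?thesis by (auto simp: \<F>_def)
        qed
      qed
      moreover have "Inf C \<le> F"
        using False sub by (auto simp: \<F>_def intro: Inf_lower2)
      ultimately show ?thesis
        by (intro bexI[of _ "Inf C"]) (auto simp: \<F>_def intro: Inf_lower)
    qed
  qed
  then obtain M where M: "M \<noteq> bot" "M \<le> F" and max: "\<And>G. G \<noteq> bot \<Longrightarrow> G \<le> M \<Longrightarrow> G = M"
    unfolding \<F>_def by (auto intro: order_trans)
  \<comment> \<open>If \<open>M\<close> does not contain \<open>P\<close>, adjoining the complement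
    of \<open>P\<close> keeps it proper, and minimality shows that the complement was there
    already.\<close>
  have "eventually P M \<or> eventually (\<lambda>x. \<not> P x) M" for P
  proof (cases "inf M (principal {x. \<not> P x}) = bot")
    case True
    then show ?thesis
      by (simp add: trivial_limit_def eventually_inf_principal)
  next
    case False
    then have "inf M (principal {x. \<not> P x}) = M"
      by (intro max) auto
    then have "M \<le> principal {x. \<not> P x}"
      by (metis inf.cobounded2)
    then show ?thesis
      by (simp add: le_principal)
  qed
  with M that show ?thesis
    by (auto simp: is_ultrafilter_def)
qed

text \<open>The image filter lives on a compact ball and so has a cluster point. Along an
  ultrafilter this is a limit: a neighbourhood that is not eventually entered would eventually be
  avoided.\<close>

lemma ultrafilter_tendsto_bounded:
  fixes a :: "'a \<Rightarrow> 'b::{heine_borel, real_normed_vector}"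
  assumes U: "is_ultrafilter U" and a: "\<And>x. norm (a x) \<le> K"
  obtains l where "(a \<longlongrightarrow> l) U"
proof -
  have nb: "filtermap a U \<noteq> bot"
    using U by (simp add: is_ultrafilter_def filtermap_bot_iff)
  have "\<forall>\<^sub>F x in filtermap a U. x \<in> cball 0 K"
    using a by (simp add: eventually_filtermap)
  with nb obtain l where l: "inf (nhds l) (filtermap a U) \<noteq> bot"
    using compact_filter[of "cball 0 K :: 'b set"] compact_cball by blast
  have "(a \<longlongrightarrow> l) U"
  proof (rule topological_tendstoI)
    fix S assume S: "open S" "l \<in> S"
    have "\<not> (\<forall>\<^sub>F x in U. a x \<notin> S)"
    proof
      assume "\<forall>\<^sub>F x in U. a x \<notin> S"
      then have "\<forall>\<^sub>F x in filtermap a U. x \<notin> S"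
        by (simp add: eventually_filtermap)
      moreover have "\<forall>\<^sub>F x in nhds l. x \<in> S"
        using S by (rule eventually_nhds_in_open)
      ultimately have "eventually (\<lambda>_. False) (inf (nhds l) (filtermap a U))"
        unfolding eventually_inf by blast
      with l show False by (simp add: trivial_limit_def)
    qed
    with U show "\<forall>\<^sub>F x in U. a x \<in> S"
      by (auto simp: is_ultrafilter_def)
  qed
  then show ?thesis ..
qed

section \<open>Complex inner product spaces\<close>

instance complex_hilbert \<subseteq> banach ..

lemma cinner_add_left: "cinner (x + y) z = cinner x z + cinner y z"
  for x y z :: "'a::complex_inner"
  by (simp add: cinner_commute[of _ z] cinner_add_right)

lemma cinner_scaleC_left: "cinner (a *\<^sub>C x) y = cnj a * cinner x y"
  for x y :: "'a::complex_inner"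
  by (simp add: cinner_commute[of _ y] cinner_scaleC_right)

lemma scaleC_minus1: "(-1) *\<^sub>C x = - x"
  for x :: "'a::complex_vector"
  by (metis complex_vector.scale_minus_left complex_vector.scale_one)

lemma cinner_minus_right [simp]: "cinner x (- y) = - cinner x y"
  for x y :: "'a::complex_inner"
  using cinner_scaleC_right[of x "-1" y] by (simp add: scaleC_minus1)

lemma cinner_diff_right: "cinner x (y - z) = cinner x y - cinner x z"
  for x y z :: "'a::complex_inner"
  by (simp only: diff_conv_add_uminus cinner_add_right cinner_minus_right)

lemma cinner_zero_right [simp]: "cinner x 0 = 0"
  for x :: "'a::complex_inner"
  using cinner_diff_right[of x x x] by simp

lemma cinner_zero_left [simp]: "cinner 0 x = 0"
  for x :: "'a::complex_inner"
  using cinner_commute[of 0 x] by simp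

lemma cinner_sum_right: "cinner x (\<Sum>i\<in>A. f i) = (\<Sum>i\<in>A. cinner x (f i))"
  for x :: "'a::complex_inner"
  by (induction A rule: infinite_finite_induct) (auto simp: cinner_add_right)

lemma cinner_self: "cinner x x = complex_of_real ((norm x)\<^sup>2)"
  for x :: "'a::complex_inner"
proof -
  have "Im (cinner x x) = 0"
    using cinner_commute[of x x] by (metis Reals_cnj_iff complex_is_Real_iff)
  \<comment> \<open>\<open>sqrt\<close> is negative on negative reals, so the nonnegative norm
    forces \<open>Re (cinner x x)\<close> to be nonnegative.\<close>
  moreover have "Re (cinner x x) = (norm x)\<^sup>2"
    using norm_ge_zero[of x] unfolding norm_eq_sqrt_cinner by simp
  ultimately show ?thesis by (simp add: complex_eq_iff)
qed

lemma norm_add_squared: "(norm (x + y))\<^sup>2 = (norm x)\<^sup>2 + 2 * Re (cinner x y) + (norm y)\<^sup>2"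
  for x y :: "'a::complex_inner"
proof -
  have "complex_of_real ((norm (x + y))\<^sup>2)
      = complex_of_real ((norm x)\<^sup>2) + (cinner x y + cnj (cinner x y)) + complex_of_real ((norm y)\<^sup>2)"
    by (simp only: cinner_self[symmetric] cinner_add_left cinner_add_right
        cinner_commute[of y x] ac_simps)
  then show ?thesis
    by (simp add: complex_eq_iff)
qed

lemma norm_diff_squared: "(norm (x - y))\<^sup>2 = (norm x)\<^sup>2 - 2 * Re (cinner x y) + (norm y)\<^sup>2"
  for x y :: "'a::complex_inner"
  using norm_add_squared[of x "- y"] by simp

lemma cinner_Cauchy_Schwarz: "cmod (cinner x y) \<le> norm x * norm y"
  for x y :: "'a::complex_inner"
proof (cases "x = 0")
  case False
  \<comment> \<open>\<open>a *\<^sub>C x\<close> is the projection of \<open>y\<close> onto the line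
    through \<open>x\<close>.\<close>
  define a where "a = cinner x y / complex_of_real ((norm x)\<^sup>2)"
  have "0 \<le> (norm (y - a *\<^sub>C x))\<^sup>2" by simp
  also have "\<dots> = (norm y)\<^sup>2 - 2 * Re (a * cnj (cinner x y)) + (cmod a * norm x)\<^sup>2"
    by (simp only: norm_diff_squared cinner_scaleC_right norm_scaleC cinner_commute[of y x])
  also have "a * cnj (cinner x y) = complex_of_real ((cmod (cinner x y))\<^sup>2 / (norm x)\<^sup>2)"
    by (simp add: a_def complex_norm_square del: of_real_power)
  also have "(cmod a * norm x)\<^sup>2 = (cmod (cinner x y))\<^sup>2 / (norm x)\<^sup>2"
    using False by (simp add: a_def norm_divide norm_mult power2_eq_square field_simps)
  finally have "(cmod (cinner x y))\<^sup>2 / (norm x)\<^sup>2 \<le> (norm y)\<^sup>2" by simp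
  with False have "(cmod (cinner x y))\<^sup>2 \<le> (norm x * norm y)\<^sup>2"
    by (simp add: field_simps power_mult_distrib)
  then show ?thesis by (rule power2_le_imp_le) simp
qed simp

lemma bounded_clinear_imp_bounded_linear:
  fixes f :: "'a::complex_normed_vector \<Rightarrow> 'b::complex_normed_vector"
  assumes "\<And>x y. f (x + y) = f x + f y" "\<And>a x. f (a *\<^sub>C x) = a *\<^sub>C f x"
    and "\<And>x. norm (f x) \<le> norm x * K"
  shows "bounded_linear f"
  by (rule bounded_linear_intro[where K = K]) (use assms in \<open>simp_all add: scaleC_of_real[symmetric]\<close>)

lemma bounded_linear_scaleC_right:
  "bounded_linear ((*\<^sub>C) a :: 'a \<Rightarrow> 'a::complex_normed_vector)"
  by (rule bounded_clinear_imp_bounded_linear[where K = "cmod a"])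
    (simp_all add: scaleC_add_right scaleC_scaleC norm_scaleC mult.commute)

section \<open>Orthonormal sequences\<close>

definition orthonormal :: "(nat \<Rightarrow> 'a::complex_inner) \<Rightarrow> bool" where
  "orthonormal e \<longleftrightarrow> (\<forall>m n. cinner (e m) (e n) = (if m = n then 1 else 0))"

lemma orthonormal_norm: "orthonormal e \<Longrightarrow> norm (e n) = 1"
  by (simp add: orthonormal_def norm_eq_sqrt_cinner)

lemma orthonormal_cinner_sum:
  assumes "orthonormal e" "finite A"
  shows "cinner (e m) (\<Sum>n\<in>A. c n *\<^sub>C e n) = (if m \<in> A then c m else 0)"
proof -
  have "cinner (e m) (\<Sum>n\<in>A. c n *\<^sub>C e n) = (\<Sum>n\<in>A. if m = n then c n else 0)"
    using assms(1) by (auto simp: cinner_sum_right cinner_scaleC_right orthonormal_def intro!: sum.cong)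
  then show ?thesis using assms(2) by simp
qed

lemma orthonormal_norm_sum:
  assumes "orthonormal e" "finite A"
  shows "(norm (\<Sum>n\<in>A. c n *\<^sub>C e n))\<^sup>2 = (\<Sum>n\<in>A. (cmod (c n))\<^sup>2)"
  using assms(2)
proof (induction A)
  case (insert k A)
  have "cinner (c k *\<^sub>C e k) (\<Sum>n\<in>A. c n *\<^sub>C e n) = 0"
    using insert by (simp add: cinner_scaleC_left orthonormal_cinner_sum[OF assms(1)])
  with insert show ?case
    by (simp add: norm_add_squared norm_scaleC orthonormal_norm[OF assms(1)])
qed simp

text \<open>For the projection \<open>p\<close> of \<open>x\<close> onto the span,
  \<open>Re (cinner x p)\<close> and the squared norm of \<open>p\<close> both equal the left side;
  then the squared norm of \<open>x - p\<close> is expanded.\<close>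

lemma Bessel_inequality:
  assumes "orthonormal e" "finite A"
  shows "(\<Sum>n\<in>A. (cmod (cinner (e n) x))\<^sup>2) \<le> (norm x)\<^sup>2"
proof -
  define p where "p = (\<Sum>n\<in>A. cinner (e n) x *\<^sub>C e n)"
  have "cinner x p = (\<Sum>n\<in>A. complex_of_real ((cmod (cinner (e n) x))\<^sup>2))"
    unfolding p_def cinner_sum_right cinner_scaleC_right
    by (intro sum.cong refl) (metis cinner_commute complex_norm_square)
  then have "Re (cinner x p) = (\<Sum>n\<in>A. (cmod (cinner (e n) x))\<^sup>2)" by simp
  moreover have "(norm p)\<^sup>2 = (\<Sum>n\<in>A. (cmod (cinner (e n) x))\<^sup>2)"
    unfolding p_def by (rule orthonormal_norm_sum[OF assms])
  moreover have "0 \<le> (norm (x - p))\<^sup>2" by simp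
  ultimately show ?thesis by (simp add: norm_diff_squared)
qed

text \<open>Gram-Schmidt: a finite orthonormal list does not span, so it can be extended by a unit
  vector orthogonal to it.\<close>

lemma orthonormal_sequence_exists:
  assumes "\<not> (\<exists>B :: 'h::complex_inner set. finite B \<and> cspan B = UNIV)"
  obtains e :: "nat \<Rightarrow> 'h::complex_inner" where "orthonormal e"
proof -
  have ex: "\<exists>v :: 'h. norm v = 1 \<and> (\<forall>b\<in>set bs. cinner b v = 0)"
    if bs: "\<And>i j. i < length bs \<Longrightarrow> j < length bs \<Longrightarrow>
        cinner (bs ! i) (bs ! j) = (if i = j then 1 else 0)" for bs
  proof -
    have "cspan (set bs) \<noteq> UNIV" using assms by blast
    then obtain x where x: "x \<notin> cspan (set bs)" by blast
    define p where "p = (\<Sum>i<length bs. cinner (bs ! i) x *\<^sub>C bs ! i)"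
    have "p \<in> cspan (set bs)" unfolding p_def
      by (intro complex_vector.span_sum complex_vector.span_scale complex_vector.span_base) auto
    with x have nz: "norm (x - p) \<noteq> 0" by auto
    have orth: "cinner b (x - p) = 0" if "b \<in> set bs" for b
    proof -
      from that obtain i where i: "i < length bs" "b = bs ! i" by (metis in_set_conv_nth)
      have "cinner b p = (\<Sum>j<length bs. if i = j then cinner (bs ! j) x else 0)"
        unfolding p_def cinner_sum_right cinner_scaleC_right i(2)
        using i bs by (intro sum.cong refl) auto
      also have "\<dots> = cinner b x" using i by simp
      finally show ?thesis by (simp add: cinner_diff_right)
    qed
    show ?thesis
      using nz orth
      by (intro exI[of _ "complex_of_real (inverse (norm (x - p))) *\<^sub>C (x - p)"])
        (auto simp: norm_scaleC cinner_scaleC_right norm_inverse)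
  qed
  \<comment> \<open>The recursion carries the list of all earlier vectors, since each choice depends
    on all of them; \<open>L n\<close> holds the first \<open>n\<close>.\<close>
  define next_vec where "next_vec bs = (SOME v :: 'h. norm v = 1 \<and> (\<forall>b\<in>set bs. cinner b v = 0))" for bs
  define L where "L = rec_nat [] (\<lambda>_ bs. bs @ [next_vec bs])"
  have L: "L 0 = []" "L (Suc n) = L n @ [next_vec (L n)]" for n
    by (simp_all add: L_def)
  define e where "e n = next_vec (L n)" for n
  have len: "length (L n) = n" for n by (induction n) (simp_all add: L)
  have nth: "L n ! i = e i" if "i < n" for i n
    using that by (induction n) (auto simp: L nth_append len e_def less_Suc_eq)
  have inv: "cinner (e i) (e j) = (if i = j then 1 else 0)" if "i < n" "j < n" for i j n
    using that
  proof (induction n arbitrary: i j)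
    case (Suc n)
    have "norm (e n) = 1 \<and> (\<forall>b\<in>set (L n). cinner b (e n) = 0)"
      unfolding e_def next_vec_def
      by (rule someI_ex, rule ex) (use Suc.IH in \<open>simp add: len nth\<close>)
    then have new: "cinner (e n) (e n) = 1" "\<And>i. i < n \<Longrightarrow> cinner (e i) (e n) = 0"
      by (auto simp: cinner_self) (metis len nth nth_mem)
    then have "\<And>i. i < n \<Longrightarrow> cinner (e n) (e i) = 0"
      by (metis cinner_commute complex_cnj_zero)
    with new Suc show ?case by (auto simp: less_Suc_eq)
  qed simp
  have "orthonormal e"
    unfolding orthonormal_def
  proof (intro allI)
    fix m n
    show "cinner (e m) (e n) = (if m = n then 1 else 0)"
      by (rule inv[of m "Suc (max m n)" n]) auto
  qed
  then show ?thesis ..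
qed

section \<open>Norms of operator matrices\<close>

abbreviation vec_norm :: "nat \<Rightarrow> (nat \<Rightarrow> 'a::real_normed_vector) \<Rightarrow> real" where
  "vec_norm n x \<equiv> L2_set (\<lambda>i. norm (x i)) {..<n}"

lemma vec_norm_squared: "(vec_norm n x)\<^sup>2 = (\<Sum>i<n. (norm (x i))\<^sup>2)"
  by (simp add: L2_set_def sum_nonneg)

lemma vec_norm_le_iff: "0 \<le> K \<Longrightarrow> vec_norm n x \<le> K \<longleftrightarrow> (\<Sum>i<n. (norm (x i))\<^sup>2) \<le> K\<^sup>2"
  unfolding vec_norm_squared[symmetric] by (auto intro: power2_le_imp_le power_mono L2_set_nonneg)

lemma vec_norm_scaleR: "vec_norm n (\<lambda>i. r *\<^sub>R x i) = \<bar>r\<bar> * vec_norm n x"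
  by (simp add: L2_set_right_distrib)

lemma norm_le_vec_norm: "i < n \<Longrightarrow> norm (x i) \<le> vec_norm n x"
  by (rule member_le_L2_set) auto

text \<open>\<open>matrix_op_norm\<close> is a supremum of reals and is informative only for a
  bounded set; the sum of bounds for the entries is a crude upper bound.\<close>

lemma matrix_op_norm_set_bounded:
  assumes "\<And>i j. i < n \<Longrightarrow> j < n \<Longrightarrow> bounded_linear (T i j)"
  shows "bdd_above {vec_norm n (\<lambda>i. \<Sum>j<n. T i j (x j)) | x. vec_norm n x \<le> 1}"
proof -
  have "\<exists>B\<ge>0. \<forall>z. norm (T i j z) \<le> norm z * B" if "i < n" "j < n" for i j
    using bounded_linear.nonneg_bounded[OF assms[OF that]] by auto
  then obtain B where B: "\<And>i j. i < n \<Longrightarrow> j < n \<Longrightarrow> 0 \<le> B i j"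
    "\<And>i j z. i < n \<Longrightarrow> j < n \<Longrightarrow> norm (T i j z) \<le> norm z * B i j"
    by metis
  have "vec_norm n (\<lambda>i. \<Sum>j<n. T i j (x j)) \<le> (\<Sum>i<n. \<Sum>j<n. B i j)" if x: "vec_norm n x \<le> 1" for x
  proof -
    have "vec_norm n (\<lambda>i. \<Sum>j<n. T i j (x j)) \<le> (\<Sum>i<n. norm (\<Sum>j<n. T i j (x j)))"
      by (rule L2_set_le_sum) auto
    also have "\<dots> \<le> (\<Sum>i<n. \<Sum>j<n. norm (T i j (x j)))"
      by (intro sum_mono norm_sum)
    also have "\<dots> \<le> (\<Sum>i<n. \<Sum>j<n. B i j)"
    proof (intro sum_mono)
      fix i j assume ij: "i \<in> {..<n}" "j \<in> {..<n}"
      then have "norm (x j) \<le> 1" using norm_le_vec_norm[of j n x] x by simp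
      then have "norm (x j) * B i j \<le> 1 * B i j" using ij B by (intro mult_right_mono) auto
      then show "norm (T i j (x j)) \<le> B i j" using B(2)[of i j "x j"] ij by simp
    qed
    finally show ?thesis .
  qed
  then show ?thesis by (auto simp: bdd_above_def)
qed

lemma matrix_op_norm_nonneg:
  assumes "\<And>i j. i < n \<Longrightarrow> j < n \<Longrightarrow> bounded_linear (T i j)"
  shows "0 \<le> matrix_op_norm n T"
proof -
  have "(\<Sum>j<n. T i j 0) = 0" if "i < n" for i
    using assms that by (intro sum.neutral) (auto simp: linear_simps)
  then have "vec_norm n (\<lambda>i. \<Sum>j<n. T i j 0) = 0"
    by (subst L2_set_eq_0_iff) auto
  then show ?thesis
    unfolding matrix_op_norm_def
    by (intro cSup_upper matrix_op_norm_set_bounded assms CollectI exI[of _ "\<lambda>_. 0"])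
      (simp_all add: L2_set_def)
qed

lemma matrix_op_norm_bound:
  assumes T: "\<And>i j. i < n \<Longrightarrow> j < n \<Longrightarrow> bounded_linear (T i j)"
  shows "vec_norm n (\<lambda>i. \<Sum>j<n. T i j (x j)) \<le> matrix_op_norm n T * vec_norm n x"
proof (cases "vec_norm n x = 0")
  case True
  then have "x j = 0" if "j < n" for j
    using norm_le_vec_norm[OF that, of x] by simp
  then have "(\<Sum>j<n. T i j (x j)) = 0" if "i < n" for i
    using T that by (intro sum.neutral) (auto simp: linear_simps)
  then have "vec_norm n (\<lambda>i. \<Sum>j<n. T i j (x j)) = 0"
    by (subst L2_set_eq_0_iff) auto
  with True show ?thesis by simp
next
  case False
  define r where "r = vec_norm n x"
  have r: "0 < r" using False by (simp add: r_def order_le_neq_trans)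
  have "vec_norm n (\<lambda>i. \<Sum>j<n. T i j (inverse r *\<^sub>R x j)) \<le> matrix_op_norm n T"
    unfolding matrix_op_norm_def
    using r by (intro cSup_upper matrix_op_norm_set_bounded T CollectI exI[of _ "\<lambda>j. inverse r *\<^sub>R x j"])
      (auto simp: vec_norm_scaleR r_def simp del: norm_scaleR)
  also have "vec_norm n (\<lambda>i. \<Sum>j<n. T i j (inverse r *\<^sub>R x j))
      = vec_norm n (\<lambda>i. inverse r *\<^sub>R (\<Sum>j<n. T i j (x j)))"
    using T by (intro L2_set_cong refl arg_cong[of _ _ norm])
      (simp add: scaleR_sum_right linear_simps)
  also have "\<dots> = inverse r * vec_norm n (\<lambda>i. \<Sum>j<n. T i j (x j))"
    using r by (simp add: vec_norm_scaleR del: norm_scaleR)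
  finally show ?thesis
    using r by (simp add: r_def[symmetric] field_simps)
qed

lemma matrix_op_norm_le:
  assumes "\<And>x. vec_norm n (\<lambda>i. \<Sum>j<n. T i j (x j)) \<le> K * vec_norm n x" "0 \<le> K"
  shows "matrix_op_norm n T \<le> K"
  unfolding matrix_op_norm_def
proof (rule cSup_least)
  have "vec_norm n (\<lambda>i. \<Sum>j<n. T i j 0)
      \<in> {vec_norm n (\<lambda>i. \<Sum>j<n. T i j (x j)) | x. vec_norm n x \<le> 1}"
    by (intro CollectI exI[of _ "\<lambda>_. 0"]) (simp add: L2_set_def)
  then show "{vec_norm n (\<lambda>i. \<Sum>j<n. T i j (x j)) | x. vec_norm n x \<le> 1} \<noteq> {}"
    by (metis empty_iff)
  fix y assume "y \<in> {vec_norm n (\<lambda>i. \<Sum>j<n. T i j (x j)) | x. vec_norm n x \<le> 1}"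
  then obtain x where "y = vec_norm n (\<lambda>i. \<Sum>j<n. T i j (x j))" "vec_norm n x \<le> 1"
    unfolding mem_Collect_eq by (elim exE conjE)
  then show "y \<le> K"
    using assms(1)[of x] mult_left_mono[of "vec_norm n x" 1 K] assms(2) by simp
qed

lemma operator_matrix_norms_1: "operator_matrix_norms 1 (\<lambda>i j. T) = norm T"
proof (rule antisym)
  have [simp]: "{..<Suc 0} = {0}" by auto
  show "operator_matrix_norms 1 (\<lambda>i j. T) \<le> norm T"
    unfolding operator_matrix_norms_def
    by (rule matrix_op_norm_le) (simp_all add: norm_blinfun)
  show "norm T \<le> operator_matrix_norms 1 (\<lambda>i j. T)"
  proof (rule norm_blinfun_bound)
    show "0 \<le> operator_matrix_norms 1 (\<lambda>i j. T)"
      unfolding operator_matrix_norms_def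
      by (rule matrix_op_norm_nonneg) (rule blinfun.bounded_linear_right)
    show "norm (blinfun_apply T x) \<le> operator_matrix_norms 1 (\<lambda>i j. T) * norm x" for x
      unfolding operator_matrix_norms_def
      using matrix_op_norm_bound[of 1 "\<lambda>i j. blinfun_apply T" "\<lambda>_. x"]
      by (simp add: blinfun.bounded_linear_right)
  qed
qed

text \<open>The combination of entries is the row \<open>y\<close> times \<open>T\<close> times the
  column \<open>x\<close>, a single operator. Such compressions reduce complete contractivity of
  maps into a commutative algebra to contractivity.\<close>

lemma norm_matrix_compression_le:
  fixes T :: "nat \<Rightarrow> nat \<Rightarrow> 'h::complex_hilbert \<Rightarrow>\<^sub>L 'h" and x y :: "nat \<Rightarrow> complex"
  assumes T: "\<And>i j. i < n \<Longrightarrow> j < n \<Longrightarrow> T i j \<in> bounded_operators"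
  shows "norm (\<Sum>i<n. \<Sum>j<n. (y i * x j) *\<^sub>C T i j)
    \<le> operator_matrix_norms n T * vec_norm n x * vec_norm n y"
proof (rule norm_blinfun_bound)
  show "0 \<le> operator_matrix_norms n T * vec_norm n x * vec_norm n y"
    unfolding operator_matrix_norms_def
    by (intro mult_nonneg_nonneg matrix_op_norm_nonneg L2_set_nonneg blinfun.bounded_linear_right)
  fix z
  define v where "v i = (\<Sum>j<n. T i j (x j *\<^sub>C z))" for i
  have "vec_norm n v \<le> operator_matrix_norms n T * vec_norm n (\<lambda>j. x j *\<^sub>C z)"
    unfolding operator_matrix_norms_def v_def
    by (intro matrix_op_norm_bound blinfun.bounded_linear_right)
  also have "vec_norm n (\<lambda>j. x j *\<^sub>C z) = vec_norm n x * norm z"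
    by (simp add: norm_scaleC L2_set_left_distrib)
  finally have v: "vec_norm n v \<le> operator_matrix_norms n T * (vec_norm n x * norm z)" .
  have "blinfun_apply (\<Sum>i<n. \<Sum>j<n. (y i * x j) *\<^sub>C T i j) z = (\<Sum>i<n. y i *\<^sub>C v i)"
    unfolding v_def
  proof (simp add: blinfun.sum_left complex_vector.scale_sum_right, intro sum.cong refl)
    \<comment> \<open>Complex linearity of \<open>T i j\<close> moves the scalar \<open>x j\<close>
      inside.\<close>
    fix i j assume "i \<in> {..<n}" "j \<in> {..<n}"
    then show "blinfun_apply ((y i * x j) *\<^sub>C T i j) z = y i *\<^sub>C blinfun_apply (T i j) (x j *\<^sub>C z)"
      using T[of i j]
      by (simp add: bounded_operators_def clinear_on_def scaleC_blinfun.rep_eq scaleC_scaleC)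
  qed
  also have "norm (\<Sum>i<n. y i *\<^sub>C v i) \<le> (\<Sum>i<n. norm (y i) * norm (v i))"
    by (rule order_trans[OF norm_sum]) (simp add: norm_scaleC)
  also have "\<dots> \<le> vec_norm n y * vec_norm n v"
    using L2_set_mult_ineq[of "\<lambda>i. norm (y i)" "\<lambda>i. norm (v i)" "{..<n}"] by simp
  also have "\<dots> \<le> vec_norm n y * (operator_matrix_norms n T * (vec_norm n x * norm z))"
    by (intro mult_left_mono v L2_set_nonneg)
  finally show "norm (blinfun_apply (\<Sum>i<n. \<Sum>j<n. (y i * x j) *\<^sub>C T i j) z)
      \<le> operator_matrix_norms n T * vec_norm n x * vec_norm n y * norm z"
    by (simp add: ac_simps)
qed

section \<open>Diagonal operators\<close>

text \<open>By Pythagoras the squared norm of a block of the series is a block of the scalar series,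
  so the Cauchy criterion carries over.\<close>

lemma orthonormal_series_summable:
  fixes e :: "nat \<Rightarrow> 'h::complex_hilbert"
  assumes e: "orthonormal e" and c: "summable (\<lambda>m. (cmod (c m))\<^sup>2)"
  shows "summable (\<lambda>m. c m *\<^sub>C e m)"
  unfolding summable_Cauchy
proof (intro allI impI)
  fix \<epsilon> :: real assume \<epsilon>: "0 < \<epsilon>"
  then have "0 < \<epsilon>\<^sup>2" by simp
  with c obtain N where N: "\<And>m n. m \<ge> N \<Longrightarrow> norm (\<Sum>k=m..<n. (cmod (c k))\<^sup>2) < \<epsilon>\<^sup>2"
    unfolding summable_Cauchy by meson
  have "norm (\<Sum>k=m..<n. c k *\<^sub>C e k) < \<epsilon>" if "m \<ge> N" for m n
  proof (rule power2_less_imp_less)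
    show "(norm (\<Sum>k=m..<n. c k *\<^sub>C e k))\<^sup>2 < \<epsilon>\<^sup>2"
      using N[OF that, of n] by (simp add: orthonormal_norm_sum[OF e] sum_nonneg)
  qed (use \<epsilon> in simp)
  then show "\<exists>N. \<forall>m\<ge>N. \<forall>n. norm (\<Sum>k=m..<n. c k *\<^sub>C e k) < \<epsilon>" by blast
qed

lemma orthonormal_series_vec_norm_le:
  fixes e :: "nat \<Rightarrow> 'h::complex_hilbert"
  assumes e: "orthonormal e" and K: "0 \<le> K"
    and c: "\<And>M. (\<Sum>i<n. \<Sum>m<M. (cmod (c i m))\<^sup>2) \<le> K\<^sup>2"
    and s: "\<And>i. i < n \<Longrightarrow> summable (\<lambda>m. c i m *\<^sub>C e m)"
  shows "vec_norm n (\<lambda>i. \<Sum>m. c i m *\<^sub>C e m) \<le> K"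
proof -
  have "(\<lambda>M. \<Sum>i<n. (norm (\<Sum>m<M. c i m *\<^sub>C e m))\<^sup>2)
      \<longlonglongrightarrow> (\<Sum>i<n. (norm (\<Sum>m. c i m *\<^sub>C e m))\<^sup>2)"
    using s by (intro tendsto_intros summable_LIMSEQ) auto
  then have "(\<Sum>i<n. (norm (\<Sum>m. c i m *\<^sub>C e m))\<^sup>2) \<le> K\<^sup>2"
    by (rule LIMSEQ_le_const2) (use c in \<open>auto simp: orthonormal_norm_sum[OF e]\<close>)
  with K show ?thesis by (simp add: vec_norm_le_iff)
qed

lemma Bessel_summable:
  assumes "orthonormal e"
  shows "summable (\<lambda>m. (cmod (cinner (e m) z))\<^sup>2)"
  by (rule bounded_imp_summable[where B = "(norm z)\<^sup>2"])
    (use Bessel_inequality[OF assms] in auto)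

text \<open>For unbounded \<open>d\<close> the map given to \<open>Blinfun\<close> need not be
  bounded and linear, so the lemmas below assume a bound on the entries.\<close>

definition diagonal_operator :: "(nat \<Rightarrow> 'h::complex_hilbert) \<Rightarrow> (nat \<Rightarrow> complex) \<Rightarrow> 'h \<Rightarrow>\<^sub>L 'h" where
  "diagonal_operator e d = Blinfun (\<lambda>z. \<Sum>m. (d m * cinner (e m) z) *\<^sub>C e m)"

context
  fixes e :: "nat \<Rightarrow> 'h::complex_hilbert"
  assumes e: "orthonormal e"
begin

lemma diagonal_series_summable:
  assumes "\<And>m. cmod (d m) \<le> K"
  shows "summable (\<lambda>m. (d m * cinner (e m) z) *\<^sub>C e m)"
proof (rule orthonormal_series_summable[OF e])
  show "summable (\<lambda>m. (cmod (d m * cinner (e m) z))\<^sup>2)"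
  proof (rule summable_comparison_test')
    show "summable (\<lambda>m. K\<^sup>2 * (cmod (cinner (e m) z))\<^sup>2)"
      by (intro summable_mult Bessel_summable e)
    show "norm ((cmod (d m * cinner (e m) z))\<^sup>2) \<le> K\<^sup>2 * (cmod (cinner (e m) z))\<^sup>2" for m
      using power_mono[OF assms[of m], of 2]
      by (simp add: norm_mult power_mult_distrib mult_right_mono)
  qed
qed

text \<open>The operator matrix splits orthogonally into the scalar matrices \<open>d i j m\<close>,
  one for each direction \<open>e m\<close>. A bound uniform in \<open>m\<close> therefore passes to
  the whole, and Bessel's inequality sums up the coordinates.\<close>

lemma diagonal_matrix_series_le:
  fixes x :: "nat \<Rightarrow> 'h" and d :: "nat \<Rightarrow> nat \<Rightarrow> nat \<Rightarrow> complex"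
  assumes K: "0 \<le> K"
    and d: "\<And>m z. vec_norm n (\<lambda>i. \<Sum>j<n. d i j m * z j) \<le> K * vec_norm n z"
    and bounded: "\<And>i j m. i < n \<Longrightarrow> j < n \<Longrightarrow> cmod (d i j m) \<le> L"
  shows "vec_norm n (\<lambda>i. \<Sum>j<n. \<Sum>m. (d i j m * cinner (e m) (x j)) *\<^sub>C e m) \<le> K * vec_norm n x"
proof -
  define c where "c i m = (\<Sum>j<n. d i j m * cinner (e m) (x j))" for i m
  have sum: "summable (\<lambda>m. (d i j m * cinner (e m) (x j)) *\<^sub>C e m)" if "i < n" "j < n" for i j
    using bounded[OF that] by (rule diagonal_series_summable)
  have split: "(\<Sum>j<n. (d i j m * cinner (e m) (x j)) *\<^sub>C e m) = c i m *\<^sub>C e m" for i m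
    by (simp add: c_def complex_vector.scale_sum_left)
  have "vec_norm n (\<lambda>i. \<Sum>m. c i m *\<^sub>C e m) \<le> K * vec_norm n x"
  proof (rule orthonormal_series_vec_norm_le[OF e])
    show "0 \<le> K * vec_norm n x" using K by (simp add: L2_set_nonneg)
    show "summable (\<lambda>m. c i m *\<^sub>C e m)" if "i < n" for i
      unfolding split[symmetric] using sum that by (intro summable_sum) auto
    fix M
    have "(\<Sum>i<n. \<Sum>m<M. (cmod (c i m))\<^sup>2) = (\<Sum>m<M. (vec_norm n (\<lambda>i. c i m))\<^sup>2)"
      unfolding vec_norm_squared by (rule sum.swap)
    also have "\<dots> \<le> (\<Sum>m<M. (K * vec_norm n (\<lambda>j. cinner (e m) (x j)))\<^sup>2)"
      unfolding c_def by (intro sum_mono power_mono d L2_set_nonneg)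
    also have "\<dots> = K\<^sup>2 * (\<Sum>j<n. \<Sum>m<M. (cmod (cinner (e m) (x j)))\<^sup>2)"
      unfolding power_mult_distrib vec_norm_squared sum_distrib_left by (rule sum.swap)
    also have "\<dots> \<le> K\<^sup>2 * (\<Sum>j<n. (norm (x j))\<^sup>2)"
      by (intro mult_left_mono sum_mono Bessel_inequality e) auto
    finally show "(\<Sum>i<n. \<Sum>m<M. (cmod (c i m))\<^sup>2) \<le> (K * vec_norm n x)\<^sup>2"
      by (simp add: power_mult_distrib vec_norm_squared)
  qed
  also have "vec_norm n (\<lambda>i. \<Sum>m. c i m *\<^sub>C e m)
      = vec_norm n (\<lambda>i. \<Sum>j<n. \<Sum>m. (d i j m * cinner (e m) (x j)) *\<^sub>C e m)"
    unfolding split[symmetric] using sum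
    by (intro L2_set_cong refl arg_cong[of _ _ norm] suminf_sum) auto
  finally show ?thesis .
qed

lemma diagonal_operator_apply:
  assumes d: "\<And>m. cmod (d m) \<le> K"
  shows "blinfun_apply (diagonal_operator e d) z = (\<Sum>m. (d m * cinner (e m) z) *\<^sub>C e m)"
  unfolding diagonal_operator_def
proof (subst bounded_linear_Blinfun_apply)
  have K: "0 \<le> K" using d[of 0] norm_ge_zero order_trans by blast
  note s = diagonal_series_summable[of d, OF d]
  show "bounded_linear (\<lambda>z. \<Sum>m. (d m * cinner (e m) z) *\<^sub>C e m)"
  proof (rule bounded_clinear_imp_bounded_linear)
    fix x y :: 'h and a
    show "(\<Sum>m. (d m * cinner (e m) (x + y)) *\<^sub>C e m)
        = (\<Sum>m. (d m * cinner (e m) x) *\<^sub>C e m) + (\<Sum>m. (d m * cinner (e m) y) *\<^sub>C e m)"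
      by (subst suminf_add[OF s s]) (simp add: cinner_add_right ring_distribs scaleC_add_left)
    show "(\<Sum>m. (d m * cinner (e m) (a *\<^sub>C x)) *\<^sub>C e m) = a *\<^sub>C (\<Sum>m. (d m * cinner (e m) x) *\<^sub>C e m)"
      by (subst bounded_linear.suminf[OF bounded_linear_scaleC_right s])
        (simp add: cinner_scaleC_right scaleC_scaleC ac_simps)
    have [simp]: "{..<Suc 0} = {0}" by auto
    \<comment> \<open>Boundedness is the 1-by-1 case of the matrix estimate.\<close>
    show "norm (\<Sum>m. (d m * cinner (e m) x) *\<^sub>C e m) \<le> norm x * K"
      using diagonal_matrix_series_le[where n = 1 and d = "\<lambda>_ _. d" and x = "\<lambda>_. x", OF K _ d]
      by (simp add: norm_mult mult_right_mono d mult.commute[of _ K])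
  qed
qed simp

lemma diagonal_operator_bounded_operators:
  assumes d: "\<And>m. cmod (d m) \<le> K"
  shows "diagonal_operator e d \<in> bounded_operators"
  unfolding bounded_operators_def clinear_on_def
proof (simp add: blinfun.add_right, intro allI)
  note s = diagonal_series_summable[of d, OF d]
  fix a x
  show "blinfun_apply (diagonal_operator e d) (a *\<^sub>C x) = a *\<^sub>C blinfun_apply (diagonal_operator e d) x"
    unfolding diagonal_operator_apply[of d, OF d]
    by (subst bounded_linear.suminf[OF bounded_linear_scaleC_right s])
      (simp add: cinner_scaleC_right scaleC_scaleC ac_simps)
qed

lemma diagonal_operator_add:
  assumes "\<And>m. cmod (c m) \<le> K" "\<And>m. cmod (d m) \<le> L"
  shows "diagonal_operator e (\<lambda>m. c m + d m) = diagonal_operator e c + diagonal_operator e d"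
proof (rule blinfun_eqI)
  have "cmod (c m + d m) \<le> K + L" for m
    using assms by (intro norm_triangle_le add_mono)
  then show "blinfun_apply (diagonal_operator e (\<lambda>m. c m + d m)) z
      = blinfun_apply (diagonal_operator e c + diagonal_operator e d) z" for z
    using diagonal_series_summable[of c, OF assms(1)] diagonal_series_summable[of d, OF assms(2)]
    by (simp add: diagonal_operator_apply[of _ "K + L"] diagonal_operator_apply[of c, OF assms(1)]
        diagonal_operator_apply[of d, OF assms(2)] blinfun.add_left suminf_add ring_distribs
        scaleC_add_left)
qed

lemma diagonal_operator_scaleC:
  assumes d: "\<And>m. cmod (d m) \<le> K"
  shows "diagonal_operator e (\<lambda>m. a * d m) = a *\<^sub>C diagonal_operator e d"
proof (rule blinfun_eqI)
  have "cmod (a * d m) \<le> cmod a * K" for m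
    using d by (simp add: norm_mult mult_left_mono)
  then show "blinfun_apply (diagonal_operator e (\<lambda>m. a * d m)) z
      = blinfun_apply (a *\<^sub>C diagonal_operator e d) z" for z
    by (simp add: diagonal_operator_apply[of _ "cmod a * K"] diagonal_operator_apply[of d, OF d]
        scaleC_blinfun.rep_eq scaleC_scaleC mult.assoc
        bounded_linear.suminf[OF bounded_linear_scaleC_right diagonal_series_summable[of d, OF d]])
qed

lemma cinner_diagonal_operator:
  assumes d: "\<And>m. cmod (d m) \<le> K"
  shows "cinner (e m) (blinfun_apply (diagonal_operator e d) (e m)) = d m"
proof -
  have "(\<lambda>k. (d k * cinner (e k) (e m)) *\<^sub>C e k) = (\<lambda>k. if k = m then d m *\<^sub>C e m else 0)"
    using e by (auto simp: orthonormal_def)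
  then have "blinfun_apply (diagonal_operator e d) (e m) = d m *\<^sub>C e m"
    using sums_If_finite_set[of "{m}" "\<lambda>_. d m *\<^sub>C e m"]
    by (simp add: diagonal_operator_apply[of d, OF d] sums_iff)
  then show ?thesis using e by (simp add: cinner_scaleC_right orthonormal_def)
qed

lemma operator_matrix_norms_diagonal_le:
  assumes K: "0 \<le> K"
    and d: "\<And>m z. vec_norm n (\<lambda>i. \<Sum>j<n. d i j m * z j) \<le> K * vec_norm n z"
    and bounded: "\<And>i j. i < n \<Longrightarrow> j < n \<Longrightarrow> \<exists>L. \<forall>m. cmod (d i j m) \<le> L"
  shows "operator_matrix_norms n (\<lambda>i j. diagonal_operator e (d i j)) \<le> K"
  unfolding operator_matrix_norms_def
proof (rule matrix_op_norm_le[OF _ K])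
  obtain L where L: "\<And>i j m. i < n \<Longrightarrow> j < n \<Longrightarrow> cmod (d i j m) \<le> L i j"
    using bounded by metis
  \<comment> \<open>The series estimate asks for one constant common to all entries.\<close>
  define L' where "L' = (\<Sum>i<n. \<Sum>j<n. \<bar>L i j\<bar>)"
  have "L i j \<le> L'" if "i < n" "j < n" for i j
  proof -
    have "L i j \<le> (\<Sum>j<n. \<bar>L i j\<bar>)"
      using that member_le_sum[of j "{..<n}" "\<lambda>j. \<bar>L i j\<bar>"] by simp
    also have "\<dots> \<le> L'"
      unfolding L'_def using that by (intro member_le_sum) (auto intro: sum_nonneg)
    finally show ?thesis .
  qed
  with L have L': "\<And>i j m. i < n \<Longrightarrow> j < n \<Longrightarrow> cmod (d i j m) \<le> L'"
    by (meson order_trans)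
  fix x :: "nat \<Rightarrow> 'h"
  have "vec_norm n (\<lambda>i. \<Sum>j<n. blinfun_apply (diagonal_operator e (d i j)) (x j))
      = vec_norm n (\<lambda>i. \<Sum>j<n. \<Sum>m. (d i j m * cinner (e m) (x j)) *\<^sub>C e m)"
    using L' by (intro L2_set_cong refl arg_cong[of _ _ norm] sum.cong diagonal_operator_apply) auto
  also have "\<dots> \<le> K * vec_norm n x"
    by (rule diagonal_matrix_series_le[OF K d L'])
  finally show "vec_norm n (\<lambda>i. \<Sum>j<n. blinfun_apply (diagonal_operator e (d i j)) (x j))
      \<le> K * vec_norm n x" .
qed

end

section \<open>The ball-covering property of $\mathcal{B}(H)$\<close>

definition rank_one :: "'h::complex_inner \<Rightarrow> 'h \<Rightarrow> 'h \<Rightarrow>\<^sub>L 'h" where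
  "rank_one y x = Blinfun (\<lambda>z. cinner x z *\<^sub>C y)"

lemma rank_one_apply [simp]: "blinfun_apply (rank_one y x) z = cinner x z *\<^sub>C y"
  unfolding rank_one_def
proof (subst bounded_linear_Blinfun_apply)
  show "bounded_linear (\<lambda>z. cinner x z *\<^sub>C y)"
  proof (rule bounded_clinear_imp_bounded_linear)
    show "norm (cinner x z *\<^sub>C y) \<le> norm z * (norm x * norm y)" for z
      using mult_right_mono[OF cinner_Cauchy_Schwarz[of x z] norm_ge_zero[of y]]
      by (simp add: norm_scaleC ac_simps)
  qed (simp_all add: cinner_add_right scaleC_add_left cinner_scaleC_right scaleC_scaleC)
qed simp

lemma rank_one_bounded_operators: "rank_one y x \<in> bounded_operators"
  by (simp add: bounded_operators_def clinear_on_def blinfun.add_right cinner_scaleC_right scaleC_scaleC)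

text \<open>Quantifies the continuity of \<open>rank_one\<close>, so that centres built from a
  countable dense set are enough.\<close>

lemma norm_rank_one_diff_le:
  "norm (rank_one y x - rank_one y' x') \<le> norm (y - y') * norm x + norm y' * norm (x - x')"
proof (rule norm_blinfun_bound)
  fix z
  have "blinfun_apply (rank_one y x - rank_one y' x') z
      = cinner x z *\<^sub>C (y - y') + cinner (x - x') z *\<^sub>C y'"
    by (simp add: blinfun.diff_left complex_vector.scale_right_diff_distrib
        complex_vector.scale_left_diff_distrib[symmetric] cinner_commute[of _ z] cinner_diff_right
        flip: complex_cnj_diff)
  also have "norm \<dots> \<le> norm (cinner x z *\<^sub>C (y - y')) + norm (cinner (x - x') z *\<^sub>C y')"
    by (rule norm_triangle_ineq)
  also have "\<dots> \<le> (norm x * norm z) * norm (y - y') + (norm (x - x') * norm z) * norm y'"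
    unfolding norm_scaleC by (intro add_mono mult_right_mono cinner_Cauchy_Schwarz norm_ge_zero)
  finally show "norm (blinfun_apply (rank_one y x - rank_one y' x') z)
      \<le> (norm (y - y') * norm x + norm y' * norm (x - x')) * norm z"
    by (simp add: algebra_simps)
qed simp

lemma norm_blinfun_le_unit:
  assumes K: "0 \<le> K" and le: "\<And>z. norm z = 1 \<Longrightarrow> norm (blinfun_apply T z) \<le> K"
  shows "norm T \<le> K"
proof (rule norm_blinfun_bound[OF K])
  fix z
  show "norm (blinfun_apply T z) \<le> K * norm z"
  proof (cases "z = 0")
    case False
    then have "norm (blinfun_apply T (inverse (norm z) *\<^sub>R z)) \<le> K" by (intro le) simp
    with False show ?thesis by (simp add: blinfun.scaleR_right field_simps)
  qed (simp add: blinfun.zero_right)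
qed

text \<open>If a contraction \<open>T\<close> nearly attains its norm at \<open>x\<close>, then \<open>z \<mapsto> \<langle>y, T z\<rangle>\<close> is
  nearly \<open>\<langle>x, z\<rangle>\<close>, so subtracting \<open>2\<langle>x, z\<rangle>y\<close> from \<open>T z\<close> acts almost as a reflection of the
  component along \<open>y\<close> and hardly increases the norm.\<close>

lemma norm_diff_rank_one_le:
  fixes T :: "'h::complex_inner \<Rightarrow>\<^sub>L 'h"
  assumes T: "T \<in> bounded_operators" "norm T \<le> 1"
    and x: "norm x = 1" "norm (blinfun_apply T x) \<ge> 49/50"
  defines "y \<equiv> complex_of_real (inverse (norm (blinfun_apply T x))) *\<^sub>C blinfun_apply T x"
  shows "norm (T - 2 *\<^sub>R rank_one y x) \<le> 3/2"
proof (rule norm_blinfun_le_unit)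
  define \<rho> where "\<rho> = norm (blinfun_apply T x)"
  define \<phi> where "\<phi> z = cinner y (blinfun_apply T z)" for z
  have contr: "norm (blinfun_apply T z) \<le> norm z" for z
    using norm_blinfun[of T z] mult_right_mono[OF T(2) norm_ge_zero[of z]] by simp
  have \<rho>: "49/50 \<le> \<rho>" "\<rho> \<le> 1" using x contr[of x] by (simp_all add: \<rho>_def)
  have y: "norm y = 1" using \<rho> by (simp add: y_def norm_scaleC norm_inverse \<rho>_def[symmetric])
  have \<phi>_add: "\<phi> (u + v) = \<phi> u + \<phi> v" and \<phi>_scale: "\<phi> (c *\<^sub>C u) = c * \<phi> u" for u v c
    using T(1) by (simp_all add: \<phi>_def bounded_operators_def clinear_on_def cinner_add_right cinner_scaleC_right)
  have \<phi>_x: "\<phi> x = complex_of_real \<rho>"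
    using \<rho> unfolding \<phi>_def y_def cinner_scaleC_left cinner_self \<rho>_def[symmetric]
    by (simp add: power2_eq_square)
  have \<phi>_le: "cmod (\<phi> z) \<le> norm z" for z
    using cinner_Cauchy_Schwarz[of y "blinfun_apply T z"] contr[of z] y by (simp add: \<phi>_def)
  fix z :: 'h assume z: "norm z = 1"
  define a where "a = cinner x z"
  define w where "w = z - a *\<^sub>C x"
  define p where "p = cmod (\<phi> w)"
  have a: "cmod a \<le> 1" using cinner_Cauchy_Schwarz[of x z] x z by (simp add: a_def)
  have xw: "cinner x w = 0"
    by (simp add: w_def cinner_diff_right cinner_scaleC_right cinner_self x a_def)
  have z_eq: "z = a *\<^sub>C x + w" by (simp add: w_def)
  have "(norm z)\<^sup>2 = (cmod a)\<^sup>2 + (norm w)\<^sup>2"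
    unfolding z_eq norm_add_squared by (simp add: cinner_scaleC_left xw norm_scaleC x)
  with z have w: "(norm w)\<^sup>2 \<le> 1" by (simp add: algebra_simps) (metis zero_le_power2 le_add_same_cancel1)
  \<comment> \<open>A phase rotating \<open>\<phi> w\<close> to a nonnegative real.\<close>
  obtain u where u: "cmod u = 1" "u * \<phi> w = complex_of_real p"
  proof (cases "p = 0")
    case True
    then show ?thesis using that[of 1] by (simp add: p_def)
  next
    case False
    have "cnj (\<phi> w) / complex_of_real p * \<phi> w = complex_of_real p"
      using False complex_norm_square[of "\<phi> w"] by (simp add: p_def[symmetric] power2_eq_square field_simps)
    then show ?thesis using False by (intro that[of "cnj (\<phi> w) / complex_of_real p"]) (auto simp: p_def norm_divide)
  qed
  \<comment> \<open>The functional \<open>\<phi>\<close> is contractive and nearly attains norm 1 at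
    \<open>x\<close>, so it is small on vectors orthogonal to \<open>x\<close>. With the weight 1/5
    the value grows by \<open>p / 5\<close>, the squared norm of the test vector by at most
    1/25.\<close>
  have "\<phi> (x + (complex_of_real (1/5) * u) *\<^sub>C w) = complex_of_real (\<rho> + 1/5 * p)"
    unfolding \<phi>_add \<phi>_scale \<phi>_x using u(2) by (simp add: mult.assoc)
  then have "\<rho> + 1/5 * p \<le> norm (x + (complex_of_real (1/5) * u) *\<^sub>C w)"
    using \<phi>_le[of "x + (complex_of_real (1/5) * u) *\<^sub>C w"] by (metis norm_of_real abs_ge_self order_trans)
  then have "(\<rho> + 1/5 * p)\<^sup>2 \<le> (norm (x + (complex_of_real (1/5) * u) *\<^sub>C w))\<^sup>2"
    using \<rho> by (intro power_mono) (auto simp: p_def)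
  also have "\<dots> = 1 + 1/25 * (norm w)\<^sup>2"
    unfolding norm_add_squared
    by (simp add: cinner_scaleC_right xw norm_scaleC x norm_mult u(1) power_mult_distrib power2_eq_square)
  also have "\<dots> \<le> 26/25" using w by simp
  finally have sq: "(\<rho> + 1/5 * p)\<^sup>2 \<le> 26/25" .
  have p: "p \<le> 7/25"
  proof (rule ccontr)
    assume "\<not> p \<le> 7/25"
    \<comment> \<open>49/50 + 7/125 exceeds 103/100, whose square exceeds 26/25.\<close>
    with \<rho> have "103/100 \<le> \<rho> + 1/5 * p" by simp
    then have "(103/100)\<^sup>2 \<le> (\<rho> + 1/5 * p)\<^sup>2" by (intro power_mono) auto
    with sq show False by (simp add: power2_eq_square)
  qed
  have \<phi>_z: "\<phi> z = a * complex_of_real \<rho> + \<phi> w"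
    by (subst z_eq) (simp only: \<phi>_add \<phi>_scale \<phi>_x)
  have "\<bar>Re (a * cnj (\<phi> w))\<bar> \<le> cmod a * p"
    using abs_Re_le_cmod[of "a * cnj (\<phi> w)"] by (simp add: norm_mult p_def)
  also have "\<dots> \<le> 1 * p" using a by (intro mult_right_mono) (auto simp: p_def)
  finally have cross: "- p \<le> Re (a * cnj (\<phi> w))" by simp
  have "a * cnj (\<phi> z) = complex_of_real (\<rho> * (cmod a)\<^sup>2) + a * cnj (\<phi> w)"
    using complex_norm_square[of a] by (simp add: \<phi>_z algebra_simps)
  then have re: "Re (a * cnj (\<phi> z)) = \<rho> * (cmod a)\<^sup>2 + Re (a * cnj (\<phi> w))" by simp
  have "cinner (blinfun_apply T z) ((2 * a) *\<^sub>C y) = 2 * (a * cnj (\<phi> z))"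
    by (simp add: cinner_scaleC_right \<phi>_def cinner_commute[of "blinfun_apply T z"])
  then have "(norm (blinfun_apply T z - (2 * a) *\<^sub>C y))\<^sup>2
      = (norm (blinfun_apply T z))\<^sup>2 - 4 * Re (a * cnj (\<phi> z)) + 4 * (cmod a)\<^sup>2"
    by (simp add: norm_diff_squared norm_scaleC y norm_mult power_mult_distrib)
  \<comment> \<open>The main part of the cross term nearly cancels
    \<open>4 * (cmod a)\<^sup>2\<close>; the rest of it costs at most \<open>4 * p\<close>.\<close>
  also have "\<dots> \<le> 1 + 4 * (1 - \<rho>) * (cmod a)\<^sup>2 + 4 * p"
    using cross power_mono[OF contr[of z], of 2] z unfolding re by (simp add: algebra_simps del: times_complex.sel)
  also have "4 * (1 - \<rho>) * (cmod a)\<^sup>2 \<le> 4 * (1 - \<rho>) * 1"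
    using \<rho> a by (intro mult_left_mono power_le_one) auto
  \<comment> \<open>At most 1 + 4/50 + 28/25 = 2.2, below 9/4.\<close>
  also have "1 + 4 * (1 - \<rho>) * 1 + 4 * p \<le> (3/2)\<^sup>2"
    using \<rho> p by (simp add: power2_eq_square)
  finally have "norm (blinfun_apply T z - (2 * a) *\<^sub>C y) \<le> 3/2"
    by (rule power2_le_imp_le) simp_all
  moreover have "blinfun_apply (T - 2 *\<^sub>R rank_one y x) z = blinfun_apply T z - (2 * a) *\<^sub>C y"
    using scaleC_of_real[of 2 "a *\<^sub>C y"]
    by (simp add: blinfun.diff_left blinfun.scaleR_left a_def scaleC_scaleC)
  ultimately show "norm (blinfun_apply (T - 2 *\<^sub>R rank_one y x) z) \<le> 3/2" by simp
qed simp

text \<open>The radius 7/4 lies between the bound 3/2 for the distance to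
  \<open>2 *\<^sub>R rank_one y x\<close> and the norm 2 of that operator, which leaves room to
  approximate \<open>x\<close> and \<open>y\<close> in a dense set.\<close>

theorem ball_covering_property_bounded_operators:
  assumes "separable_space (euclidean :: 'h::complex_inner topology)"
  shows "ball_covering_property (bounded_operators :: ('h \<Rightarrow>\<^sub>L 'h) set)"
proof -
  obtain D :: "'h set" where D: "countable D" "closure D = UNIV"
    using assms unfolding separable_space_def by (auto simp: euclidean_closure_of)
  have near: "\<exists>x'\<in>D. norm (x - x') < 1/20" for x :: 'h
  proof -
    have "0 < (1/20 :: real)" by simp
    then show ?thesis
      using closure_approachable[of x D] D(2) by (metis UNIV_I dist_commute dist_norm)
  qed
  \<comment> \<open>Keeping only the centres of norm above 7/4 keeps the origin out of every ball;
    vectors of \<open>D\<close> need not have norm 1.\<close>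
  define \<B> where "\<B> = (\<lambda>c. (c, 7/4 :: real)) `
      {c \<in> (\<lambda>(y, x). 2 *\<^sub>R rank_one y x) ` (D \<times> D). 7/4 < norm c}"
  have "countable \<B>"
    unfolding \<B>_def using D(1)
    by (intro countable_image countable_subset[OF Collect_restrict] countable_SIGMA)
  moreover have "2 *\<^sub>R R \<in> bounded_operators" if "R \<in> bounded_operators" for R :: "'h \<Rightarrow>\<^sub>L 'h"
    using that scaleC_of_real[of 2]
    by (auto simp: bounded_operators_def clinear_on_def blinfun.add_right scaleC_blinfun.rep_eq
        scaleC_scaleC mult.commute simp flip: scaleC_of_real)
  then have "\<forall>(c, r)\<in>\<B>. c \<in> bounded_operators \<and> 0 < r \<and> 0 \<notin> cball c r"
    using rank_one_bounded_operators by (auto simp: \<B>_def)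
  moreover have "bounded_operators \<inter> sphere 0 1 \<subseteq> (\<Union>(c, r)\<in>\<B>. cball c r)"
  proof
    fix T :: "'h \<Rightarrow>\<^sub>L 'h" assume "T \<in> bounded_operators \<inter> sphere 0 1"
    then have T: "T \<in> bounded_operators" "norm T = 1" by (auto simp: dist_norm)
    have "\<exists>x. norm x = 1 \<and> norm (blinfun_apply T x) \<ge> 49/50"
    proof (rule ccontr)
      assume "\<not> ?thesis"
      then have "norm T \<le> 49/50" by (intro norm_blinfun_le_unit) (auto simp: not_le intro: less_imp_le)
      with T show False by simp
    qed
    then obtain x where x: "norm x = 1" "norm (blinfun_apply T x) \<ge> 49/50" by blast
    define y where "y = complex_of_real (inverse (norm (blinfun_apply T x))) *\<^sub>C blinfun_apply T x"
    have "norm (blinfun_apply T x) \<noteq> 0" using x by linarith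
    then have y: "norm y = 1" by (simp add: y_def norm_scaleC norm_inverse)
    have TR: "norm (T - 2 *\<^sub>R rank_one y x) \<le> 3/2"
      unfolding y_def using norm_diff_rank_one_le[OF T(1) _ x] T(2) by simp
    obtain x' y' where D': "x' \<in> D" "y' \<in> D" and xx: "norm (x - x') < 1/20" and yy: "norm (y - y') < 1/20"
      using near by meson
    have "norm y' \<le> 21/20"
      using norm_triangle_sub[of y' y] y yy by (simp add: norm_minus_commute)
    \<comment> \<open>The sum is 41/400, and twice it is below the slack 1/4 that 7/4 has from both
      3/2 and 2.\<close>
    then have "norm (y - y') * norm x + norm y' * norm (x - x') \<le> 1/20 * 1 + 21/20 * (1/20)"
      using x xx yy by (intro add_mono mult_mono) auto
    with norm_rank_one_diff_le[of y x y' x']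
    have "norm (rank_one y x - rank_one y' x') \<le> 41/400" by simp
    then have RR: "norm (2 *\<^sub>R rank_one y x - 2 *\<^sub>R rank_one y' x') \<le> 41/200"
      by (simp flip: scaleR_diff_right)
    have "1 = norm (blinfun_apply (rank_one y x) x)"
      by (simp add: cinner_self x y)
    also have "\<dots> \<le> norm (rank_one y x)"
      using norm_blinfun[of "rank_one y x" x] x by simp
    finally have "2 \<le> norm (2 *\<^sub>R rank_one y x)" by simp
    with RR norm_triangle_ineq2[of "2 *\<^sub>R rank_one y x" "2 *\<^sub>R rank_one y' x'"]
    have "7/4 < norm (2 *\<^sub>R rank_one y' x')" by simp
    with D' have "(2 *\<^sub>R rank_one y' x', 7/4) \<in> \<B>" by (auto simp: \<B>_def)
    moreover have "norm (T - 2 *\<^sub>R rank_one y' x') \<le> 7/4"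
      using norm_triangle_ineq[of "T - 2 *\<^sub>R rank_one y x" "2 *\<^sub>R rank_one y x - 2 *\<^sub>R rank_one y' x'"] TR RR
      by simp
    ultimately show "T \<in> (\<Union>(c, r)\<in>\<B>. cball c r)"
      by (intro UN_I[of "(2 *\<^sub>R rank_one y' x', 7/4)"]) (auto simp: dist_norm norm_minus_commute)
  qed
  ultimately show ?thesis unfolding ball_covering_property_def by blast
qed

section \<open>Representatives of elements of $L_\infty[0,1]$\<close>

lemma finite_measure_unit: "finite_measure unit_measure"
  by (rule finite_measureI) (simp add: emeasure_restrict_space)

interpretation unit: finite_measure unit_measure
  by (rule finite_measure_unit)

lemma ess_bounded_rep: "ess_bounded (rep_linf F)"
  using Quotient3_rep_reflp[OF Quotient3_linf, of F] by (simp add: ess_eq_def)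

lemma rep_linf_measurable [measurable]: "rep_linf F \<in> borel_measurable unit_measure"
  using ess_bounded_rep[of F] by (simp add: ess_bounded_def)

text \<open>Representatives are determined only up to null sets, so the algebraic rules for
  \<open>rep_linf\<close> hold almost everywhere.\<close>

lemma rep_abs_linf: "ess_bounded f \<Longrightarrow> AE t in unit_measure. rep_linf (abs_linf f) t = f t"
  using Quotient3_rep_abs[OF Quotient3_linf, of f] by (simp add: ess_eq_def)

lemma rep_linf_plus: "AE t in unit_measure. rep_linf (F + G) t = rep_linf F t + rep_linf G t"
  unfolding plus_linf_def by (simp add: rep_abs_linf ess_bounded_add ess_bounded_rep)

lemma rep_linf_minus: "AE t in unit_measure. rep_linf (F - G) t = rep_linf F t - rep_linf G t"
  unfolding minus_linf_def by (simp add: rep_abs_linf ess_bounded_diff ess_bounded_rep)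

lemma rep_linf_scaleC: "AE t in unit_measure. rep_linf (a *\<^sub>C F) t = a * rep_linf F t"
  unfolding scaleC_linf_def by (simp add: rep_abs_linf ess_bounded_cmult ess_bounded_rep)

lemma rep_linf_zero: "AE t in unit_measure. rep_linf 0 t = 0"
  unfolding zero_linf_def by (simp add: rep_abs_linf ess_bounded_0)

lemma rep_linf_sum:
  "finite I \<Longrightarrow> AE t in unit_measure. rep_linf (\<Sum>i\<in>I. F i) t = (\<Sum>i\<in>I. rep_linf (F i) t)"
proof (induction I rule: finite_induct)
  case empty
  then show ?case using rep_linf_zero by simp
next
  case (insert i I)
  from insert.IH rep_linf_plus[of "F i" "\<Sum>i\<in>I. F i"] show ?case
    by eventually_elim (simp add: insert.hyps)
qed

lemma linf_eqI: "AE t in unit_measure. rep_linf F t = rep_linf G t \<Longrightarrow> F = G"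
  using Quotient3_rel_rep[OF Quotient3_linf, of F G] by (simp add: ess_eq_def ess_bounded_rep)

lemma AE_rep_linf_le: "AE t in unit_measure. cmod (rep_linf F t) \<le> norm F"
proof -
  have "AE t in unit_measure. ereal (cmod (rep_linf F t)) \<le> ess_norm (rep_linf F)"
    unfolding ess_norm_def by (rule esssup_AE)
  then have "AE t in unit_measure. ereal (cmod (rep_linf F t)) \<le> ereal (norm F)"
    by (simp add: norm_linf_def ess_norm_real[OF ess_bounded_rep])
  then show ?thesis by simp
qed

lemma norm_linf_le:
  assumes "AE t in unit_measure. cmod (rep_linf F t) \<le> K"
  shows "norm F \<le> K"
proof -
  have "ess_norm (rep_linf F) \<le> ereal K"
    unfolding ess_norm_def by (rule esssup_I) (use assms in auto)
  then have "ereal (norm F) \<le> ereal K"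
    by (simp add: norm_linf_def ess_norm_real[OF ess_bounded_rep])
  then show ?thesis by simp
qed

lemma rep_linf_integrable: "integrable unit_measure (rep_linf F)"
  by (rule unit.integrable_const_bound[OF AE_rep_linf_le]) measurable

text \<open>Shows that a covering family is nonempty and, later, that the norm of the projection is
  not below 1.\<close>

lemma ex_norm_1_linf: "\<exists>F :: linf. norm F = 1"
proof
  have "ess_bounded (\<lambda>_. 1)" by (auto simp: ess_bounded_iff)
  then have "norm (abs_linf (\<lambda>_. 1)) = real_of_ereal (ess_norm (\<lambda>_. 1))"
    by (simp add: norm_linf.abs_eq ess_eq_def)
  also have "ess_norm (\<lambda>_. 1) = 1"
    unfolding ess_norm_def by (simp add: esssup_const emeasure_restrict_space)
  finally show "norm (abs_linf (\<lambda>_. 1)) = 1" by simp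
qed

section \<open>Partition cells of the unit interval\<close>

text \<open>\<open>cell k j\<close> is \<open>[j/(k+1), (j+1)/(k+1)) \<inter> [0,1]\<close>; it is empty for \<open>j > k + 1\<close>, and for
  \<open>j = k + 1\<close> it is the null set \<open>{1}\<close>.\<close>

definition cell :: "nat \<Rightarrow> nat \<Rightarrow> real set" where
  "cell k j = {t \<in> {0..1}. nat \<lfloor>t * Suc k\<rfloor> = j}"

lemma cell_measurable [measurable]: "cell k j \<in> sets unit_measure"
proof -
  have "{t :: real. nat \<lfloor>t * Suc k\<rfloor> = j} \<in> sets borel" by measurable
  then have "{t :: real. nat \<lfloor>t * Suc k\<rfloor> = j} \<in> sets lebesgue" by simp
  moreover have "cell k j = {0..1} \<inter> {t. nat \<lfloor>t * Suc k\<rfloor> = j}" by (auto simp: cell_def)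
  ultimately show ?thesis by (auto simp: sets_restrict_space)
qed

lemma measure_unit_eq:
  "A \<in> sets unit_measure \<Longrightarrow> measure unit_measure A = measure lebesgue A"
  by (simp add: measure_restrict_space sets_restrict_space_iff)

lemma measure_cell_le: "measure unit_measure (cell k j) \<le> 1 / Suc k"
proof -
  have "cell k j \<subseteq> {real j / Suc k..(real j + 1) / Suc k}"
    by (auto simp: cell_def field_simps) linarith+
  then have "measure lebesgue (cell k j) \<le> measure lebesgue {real j / Suc k..(real j + 1) / Suc k}"
    using cell_measurable[of k j]
    by (intro measure_mono_fmeasurable) (auto simp: sets_restrict_space_iff)
  also have "\<dots> = 1 / Suc k"
    by (simp add: divide_right_mono diff_divide_distrib[symmetric])
  finally show ?thesis
    by (simp add: measure_unit_eq)
qed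

lemma UN_cell: "(\<Union>j. cell k j) = {0..1}"
  by (auto simp: cell_def)

text \<open>Countably many cells of length below \<open>\<epsilon>\<close> cover \<open>A\<close>,
  so one of them meets \<open>A\<close> in positive measure.\<close>

lemma small_positive_subset:
  assumes A: "A \<in> sets unit_measure" "0 < measure unit_measure A" and \<epsilon>: "0 < \<epsilon>"
  obtains B where "B \<in> sets unit_measure" "B \<subseteq> A" "0 < measure unit_measure B"
    "measure unit_measure B \<le> \<epsilon>"
proof -
  obtain k where k: "1 / Suc k < \<epsilon>"
    using \<epsilon> nat_approx_posE by (metis of_nat_Suc)
  have "\<exists>j. 0 < measure unit_measure (A \<inter> cell k j)"
  proof (rule ccontr)
    assume "\<not> ?thesis"
    then have "A \<inter> cell k j \<in> null_sets unit_measure" for j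
      using A by (auto simp: null_sets_def unit.emeasure_eq_measure not_less measure_le_0_iff)
    then have "(\<Union>j. A \<inter> cell k j) \<in> null_sets unit_measure"
      by (rule null_sets_UN)
    moreover have "(\<Union>j. A \<inter> cell k j) = A"
      using sets.sets_into_space[OF A(1)] UN_cell[of k] by auto
    ultimately show False
      using A by (simp add: null_sets_def unit.emeasure_eq_measure)
  qed
  then obtain j where j: "0 < measure unit_measure (A \<inter> cell k j)" ..
  show ?thesis
  proof (rule that)
    have "measure unit_measure (A \<inter> cell k j) \<le> measure unit_measure (cell k j)"
      by (intro unit.finite_measure_mono) auto
    with measure_cell_le[of k j] k show "measure unit_measure (A \<inter> cell k j) \<le> \<epsilon>" by linarith
  qed (use A j in auto)
qed

section \<open>Failure of the ball-covering property\<close>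

text \<open>Choosing \<open>B n \<subseteq> A n\<close> with rapidly decreasing measures leaves a positive part of each
  \<open>B n\<close> outside all the later ones.\<close>

lemma disjoint_positive_subsets:
  assumes A: "\<And>n :: nat. A n \<in> sets unit_measure" "\<And>n. 0 < measure unit_measure (A n)"
  shows "\<exists>C. disjoint_family C \<and>
    (\<forall>n. C n \<in> sets unit_measure \<and> C n \<subseteq> A n \<and> 0 < measure unit_measure (C n))"
proof -
  have "\<exists>B. \<forall>n. (B n \<in> sets unit_measure \<and> B n \<subseteq> A n \<and> 0 < measure unit_measure (B n))
      \<and> measure unit_measure (B (Suc n)) \<le> measure unit_measure (B n) / 4"
  proof (rule dependent_nat_choice)
    show "\<exists>B. B \<in> sets unit_measure \<and> B \<subseteq> A 0 \<and> 0 < measure unit_measure B"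
      using A by blast
    fix B n assume "B \<in> sets unit_measure \<and> B \<subseteq> A n \<and> 0 < measure unit_measure B"
    then show "\<exists>B'. (B' \<in> sets unit_measure \<and> B' \<subseteq> A (Suc n) \<and> 0 < measure unit_measure B')
        \<and> measure unit_measure B' \<le> measure unit_measure B / 4"
      using small_positive_subset[OF A(1)[of "Suc n"] A(2)[of "Suc n"], of "measure unit_measure B / 4"]
      by (metis divide_pos_pos zero_less_numeral)
  qed
  then obtain B where B: "\<And>n. B n \<in> sets unit_measure" "\<And>n. B n \<subseteq> A n"
    "\<And>n. 0 < measure unit_measure (B n)"
    "\<And>n. measure unit_measure (B (Suc n)) \<le> measure unit_measure (B n) / 4"
    by blast
  define C where "C n = B n - (\<Union>i. B (n + Suc i))" for n
  have decr: "measure unit_measure (B (n + i)) \<le> measure unit_measure (B n) * (1/4) ^ i" for n i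
  proof (induction i)
    case (Suc i)
    then show ?case using B(4)[of "n + i"] by simp
  qed simp
  have "0 < measure unit_measure (C n)" for n
  proof -
    \<comment> \<open>The powers of 1/4 from the first on sum to 1/3, so the later sets leave at
      least two thirds of \<open>B n\<close>.\<close>
    have sums: "(\<lambda>i. measure unit_measure (B n) * (1/4) ^ Suc i) sums (measure unit_measure (B n) / 3)"
      using sums_mult[OF geometric_sums[of "1/4 :: real"], of "measure unit_measure (B n) / 4"] by simp
    have le: "measure unit_measure (B (n + Suc i)) \<le> measure unit_measure (B n) * (1/4) ^ Suc i" for i
      by (rule decr)
    have summable: "summable (\<lambda>i. measure unit_measure (B (n + Suc i)))"
      by (rule summable_comparison_test'[OF sums_summable[OF sums]]) (use le in simp)
    have "measure unit_measure (\<Union>i. B (n + Suc i)) \<le> (\<Sum>i. measure unit_measure (B (n + Suc i)))"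
      using B(1) summable by (intro unit.finite_measure_subadditive_countably) auto
    also have "\<dots> \<le> (\<Sum>i. measure unit_measure (B n) * (1/4) ^ Suc i)"
      by (rule suminf_le[OF le summable sums_summable[OF sums]])
    also have "\<dots> = measure unit_measure (B n) / 3"
      using sums by (rule sums_unique[symmetric])
    finally have U: "measure unit_measure (\<Union>i. B (n + Suc i)) \<le> measure unit_measure (B n) / 3" .
    have "measure unit_measure (B n) \<le> measure unit_measure (C n \<union> (\<Union>i. B (n + Suc i)))"
      using B(1) by (intro unit.finite_measure_mono) (auto simp: C_def)
    also have "\<dots> \<le> measure unit_measure (C n) + measure unit_measure (\<Union>i. B (n + Suc i))"
      using B(1) by (intro measure_Un_le) (auto simp: C_def)
    finally show ?thesis using U B(3)[of n] by linarith
  qed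
  moreover have "C m \<inter> C n = {}" if "m < n" for m n
    using that less_imp_Suc_add[OF that] by (auto simp: C_def)
  then have "disjoint_family C"
    unfolding disjoint_family_on_def by (metis Int_commute linorder_neqE_nat)
  moreover have "C n \<in> sets unit_measure" "C n \<subseteq> A n" for n
    using B by (auto simp: C_def)
  ultimately show ?thesis by (intro exI[of _ C]) auto
qed

text \<open>On \<open>C n\<close> the function \<open>F\<close> has modulus 1 and points opposite to
  \<open>c n\<close>, so the pointwise distance is the modulus of \<open>c n\<close> plus 1.
  Disjointness allows this for all \<open>n\<close> at once.\<close>

lemma linf_avoids_balls:
  assumes r: "\<And>n :: nat. 0 < r n" "\<And>n. r n < norm (c n)"
  obtains F :: linf where "norm F = 1" "\<And>n. r n < norm (c n - F)"
proof -
  define A where "A n = {t \<in> space unit_measure. r n < cmod (rep_linf (c n) t)}" for n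
  have A [measurable]: "A n \<in> sets unit_measure" for n
    unfolding A_def by measurable
  have A_pos: "0 < measure unit_measure (A n)" for n
  proof (rule ccontr)
    assume "\<not> ?thesis"
    then have "A n \<in> null_sets unit_measure"
      using A by (auto simp: null_sets_def unit.emeasure_eq_measure not_less measure_le_0_iff)
    then have "AE t in unit_measure. t \<notin> A n" by (rule AE_not_in)
    then have "AE t in unit_measure. cmod (rep_linf (c n) t) \<le> r n"
      using AE_space by eventually_elim (simp add: A_def)
    with r(2)[of n] show False using norm_linf_le[of "c n" "r n"] by simp
  qed
  obtain C where
    C [measurable]: "\<And>n. C n \<in> sets unit_measure" and CA: "\<And>n. C n \<subseteq> A n"
    and pos: "\<And>n. 0 < measure unit_measure (C n)" and disj: "disjoint_family C"
    using disjoint_positive_subsets[of A, OF A A_pos] by auto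
  \<comment> \<open>By disjointness the least index is the only one; the form with
    \<open>LEAST\<close> makes measurability routine.\<close>
  define idx where "idx t = (LEAST n. t \<in> C n)" for t
  have idx_eq: "idx t = n" if "t \<in> C n" for t n
    unfolding idx_def
  proof (rule Least_equality)
    show "t \<in> C n" by (rule that)
    fix m assume "t \<in> C m"
    with that have "C m \<inter> C n \<noteq> {}" by auto
    with disjoint_family_onD[OF disj, of m n] have "m = n" by auto
    then show "n \<le> m" by simp
  qed
  have idx_measurable [measurable]: "idx \<in> unit_measure \<rightarrow>\<^sub>M count_space UNIV"
    unfolding idx_def by measurable
  define h where "h n t = - rep_linf (c n) t / complex_of_real (cmod (rep_linf (c n) t))" for n t
  have h_measurable [measurable]: "h n \<in> borel_measurable unit_measure" for n
    unfolding h_def by measurable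
  define g where "g t = (if t \<in> (\<Union>n. C n) then h (idx t) t else 1)" for t
  have "(\<lambda>t. h (idx t) t) \<in> borel_measurable unit_measure"
    by (rule measurable_compose_countable) measurable
  then have g_measurable: "g \<in> borel_measurable unit_measure"
    unfolding g_def by measurable
  have cmod_g: "cmod (g t) = 1" for t
  proof (cases "t \<in> (\<Union>n. C n)")
    case True
    then obtain n where n: "t \<in> C n" by blast
    \<comment> \<open>Positivity of \<open>r n\<close> keeps the denominator in \<open>h\<close>
      away from zero.\<close>
    with CA r(1)[of n] have "0 < cmod (rep_linf (c n) t)" by (fastforce simp: A_def)
    with n True show ?thesis by (simp add: g_def idx_eq h_def norm_divide)
  qed (simp add: g_def)
  with g_measurable have g: "ess_bounded g"
    by (auto simp: ess_bounded_iff)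
  define F where "F = abs_linf g"
  have Fg: "AE t in unit_measure. rep_linf F t = g t"
    unfolding F_def by (rule rep_abs_linf[OF g])
  \<comment> \<open>What fails throughout some \<open>C n\<close> cannot hold almost everywhere;
    this turns pointwise values into lower bounds for norms.\<close>
  have nonnull: "\<not> (AE t in unit_measure. P t)" if "\<And>t. t \<in> C n \<Longrightarrow> \<not> P t" for n P
  proof
    assume "AE t in unit_measure. P t"
    then have "AE t in unit_measure. t \<notin> C n" by eventually_elim (use that in blast)
    then have "C n \<in> null_sets unit_measure" using AE_iff_null_sets[OF C] by simp
    with pos[of n] show False by (simp add: null_sets_def unit.emeasure_eq_measure)
  qed
  show ?thesis
  proof (rule that[of F])
    show "norm F = 1"
    proof (rule antisym)
      show "norm F \<le> 1" by (rule norm_linf_le) (use Fg cmod_g in auto)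
      show "1 \<le> norm F"
      proof (rule ccontr)
        assume *: "\<not> 1 \<le> norm F"
        from Fg AE_rep_linf_le[of F] have "AE t in unit_measure. cmod (g t) \<le> norm F"
          by eventually_elim simp
        with nonnull[of 0 "\<lambda>t. cmod (g t) \<le> norm F"] cmod_g * show False by simp
      qed
    qed
    fix n
    show "r n < norm (c n - F)"
    proof (rule ccontr)
      assume *: "\<not> r n < norm (c n - F)"
      from Fg rep_linf_minus[of "c n" F] AE_rep_linf_le[of "c n - F"]
      have AE: "AE t in unit_measure. cmod (rep_linf (c n) t - g t) \<le> r n"
        by eventually_elim (use * in simp)
      have "\<not> cmod (rep_linf (c n) t - g t) \<le> r n" if t: "t \<in> C n" for t
      proof -
        define s where "s = cmod (rep_linf (c n) t)"
        have s: "r n < s" "0 < s" using CA[of n] t r(1)[of n] by (auto simp: A_def s_def)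
        have "rep_linf (c n) t - g t = rep_linf (c n) t * complex_of_real (1 + 1 / s)"
          using t by (auto simp: g_def idx_eq h_def s_def algebra_simps)
        then have "cmod (rep_linf (c n) t - g t) = s * (1 + 1 / s)"
          using s by (simp add: norm_mult s_def[symmetric] del: of_real_add)
        moreover have "s * (1 + 1 / s) = s + 1" using s by (simp add: field_simps)
        ultimately show ?thesis using s by simp
      qed
      with AE nonnull[of n "\<lambda>t. cmod (rep_linf (c n) t - g t) \<le> r n"] show False by simp
    qed
  qed
qed

theorem not_ball_covering_property_linf: "\<not> ball_covering_property (UNIV :: linf set)"
proof
  assume "ball_covering_property (UNIV :: linf set)"
  then obtain \<B> :: "(linf \<times> real) set" where \<B>: "countable \<B>"
    "\<forall>(c, r)\<in>\<B>. 0 < r \<and> 0 \<notin> cball c r" "sphere 0 1 \<subseteq> (\<Union>(c, r)\<in>\<B>. cball c r)"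
    unfolding ball_covering_property_def by auto
  obtain F\<^sub>0 :: linf where "norm F\<^sub>0 = 1"
    using ex_norm_1_linf by blast
  \<comment> \<open>\<open>from_nat_into\<close> enumerates a countable set, with repetitions if it
    is finite, provided it is nonempty.\<close>
  with \<B>(3) have ne: "\<B> \<noteq> {}" by (auto simp: subset_iff dist_norm)
  define c r where "c n = fst (from_nat_into \<B> n)" and "r n = snd (from_nat_into \<B> n)" for n
  have in\<B>: "(c n, r n) \<in> \<B>" for n
    using from_nat_into[OF ne, of n] by (simp add: c_def r_def)
  have "0 < r n" "r n < norm (c n)" for n
    using bspec[OF \<B>(2) in\<B>[of n]] by (auto simp: dist_norm)
  then obtain F where F: "norm F = 1" "\<And>n. r n < norm (c n - F)"
    using linf_avoids_balls[of r c] by blast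
  have "F \<in> (\<Union>(c, r)\<in>\<B>. cball c r)" using F(1) \<B>(3) by (auto simp: subset_iff)
  then obtain b where b: "b \<in> \<B>" "F \<in> cball (fst b) (snd b)" by auto
  obtain n where "b = from_nat_into \<B> n" using from_nat_into_surj[OF \<B>(1) b(1)] by auto
  with b(2) F(2)[of n] show False by (simp add: dist_norm c_def r_def)
qed

section \<open>Densities of bounded additive set functions\<close>

text \<open>Adding a multiple of the measure makes the set function nonnegative, Radon-Nikodym
  applies, and the constant is subtracted from the density afterwards.\<close>

lemma (in finite_measure) bounded_additive_real_density:
  fixes \<phi> :: "'a set \<Rightarrow> real"
  assumes add: "\<And>A B. A \<in> sets M \<Longrightarrow> B \<in> sets M \<Longrightarrow> A \<inter> B = {} \<Longrightarrow> \<phi> (A \<union> B) = \<phi> A + \<phi> B"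
    and bound: "\<And>A. A \<in> sets M \<Longrightarrow> \<bar>\<phi> A\<bar> \<le> C * measure M A"
  shows "\<exists>g. integrable M g \<and> (\<forall>A\<in>sets M. (LINT t:A|M. g t) = \<phi> A)"
proof -
  define \<nu> where "\<nu> A = \<phi> A + \<bar>C\<bar> * measure M A" for A
  have "C * measure M A \<le> \<bar>C\<bar> * measure M A" for A
    by (intro mult_right_mono) auto
  with bound have bound': "\<bar>\<phi> A\<bar> \<le> \<bar>C\<bar> * measure M A" if "A \<in> sets M" for A
    using that by (meson order_trans)
  have \<nu>_nonneg: "0 \<le> \<nu> A" and \<nu>_le: "\<nu> A \<le> 2 * \<bar>C\<bar> * measure M A" if "A \<in> sets M" for A
    using bound'[OF that] by (auto simp: \<nu>_def)
  have \<nu>_add: "\<nu> (A \<union> B) = \<nu> A + \<nu> B" if "A \<in> sets M" "B \<in> sets M" "A \<inter> B = {}" for A B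
    using that by (simp add: \<nu>_def add finite_measure_Union algebra_simps)
  have \<nu>_empty: "\<nu> {} = 0" using \<nu>_le[of "{}"] \<nu>_nonneg[of "{}"] by simp
  define N where "N = measure_of (space M) (sets M) (\<lambda>A. ennreal (\<nu> A))"
  have ca: "countably_additive (sets M) (\<lambda>A. ennreal (\<nu> A))"
  \<comment> \<open>Finite additivity becomes countable additivity because \<open>\<nu>\<close> is
    dominated by the measure, which tends to 0 along sets decreasing to the empty set.\<close>
  proof (rule sets.empty_continuous_imp_countably_additive)
    show "positive (sets M) (\<lambda>A. ennreal (\<nu> A))"
      by (simp add: positive_def \<nu>_empty)
    show "Measure_Space.additive (sets M) (\<lambda>A. ennreal (\<nu> A))"
      by (auto simp: Measure_Space.additive_def \<nu>_add \<nu>_nonneg ennreal_plus)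
    fix A :: "nat \<Rightarrow> 'a set" assume A: "range A \<subseteq> sets M" "decseq A" "(\<Inter>i. A i) = {}"
    have "(\<lambda>i. measure M (A i)) \<longlonglongrightarrow> 0"
      using finite_Lim_measure_decseq[OF A(1,2)] A(3) by simp
    then have lim: "(\<lambda>i. 2 * \<bar>C\<bar> * measure M (A i)) \<longlonglongrightarrow> 0"
      by (rule tendsto_mult_right_zero)
    have "norm (\<nu> (A i)) \<le> 2 * \<bar>C\<bar> * measure M (A i)" for i
      using A(1) \<nu>_nonneg[of "A i"] \<nu>_le[of "A i"] by auto
    then have "(\<lambda>i. \<nu> (A i)) \<longlonglongrightarrow> 0"
      by (intro Lim_null_comparison[OF _ lim] always_eventually allI)
    from tendsto_ennrealI[OF this] show "(\<lambda>i. ennreal (\<nu> (A i))) \<longlonglongrightarrow> 0"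
      by simp
  qed simp
  have sets_N: "sets N = sets M" by (simp add: N_def)
  have N: "emeasure N A = ennreal (\<nu> A)" if "A \<in> sets M" for A
    unfolding N_def using that ca
    by (intro emeasure_measure_of[OF refl]) (auto simp: positive_def \<nu>_empty sets_N[unfolded N_def] dest: sets.sets_into_space)
  have "absolutely_continuous M N"
  proof (unfold absolutely_continuous_def, rule subsetI)
    fix A assume "A \<in> null_sets M"
    then have A: "A \<in> sets M" "measure M A = 0" by (auto simp: null_sets_def measure_def)
    with \<nu>_le[of A] \<nu>_nonneg[of A] have "\<nu> A = 0" by simp
    with A show "A \<in> null_sets N" by (simp add: null_sets_def N sets_N)
  qed
  then obtain f where f [measurable]: "f \<in> borel_measurable M" and fN: "density M f = N"
    using Radon_Nikodym sets_N by blast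
  have f_int: "(\<integral>\<^sup>+ t. f t * indicator A t \<partial>M) = ennreal (\<nu> A)" if "A \<in> sets M" for A
    using N[OF that] that by (simp add: fN[symmetric] emeasure_density)
  have "(\<integral>\<^sup>+ t. f t \<partial>M) = ennreal (\<nu> (space M))"
    using f_int[of "space M"] by (simp cong: nn_integral_cong)
  then have fin: "AE t in M. f t \<noteq> \<infinity>"
    by (intro nn_integral_noteq_infinite) auto
  \<comment> \<open>The density has finite integral, hence is finite almost everywhere, and passing
    to reals changes it only on a null set.\<close>
  define h where "h t = enn2real (f t)" for t
  have h [measurable]: "h \<in> borel_measurable M" unfolding h_def by measurable
  have h_int: "integrable M (\<lambda>t. indicator A t * h t) \<and> (\<integral>t. indicator A t * h t \<partial>M) = \<nu> A"
    if A [measurable]: "A \<in> sets M" for A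
  proof -
    have "(\<integral>\<^sup>+ t. ennreal (indicator A t * h t) \<partial>M) = (\<integral>\<^sup>+ t. f t * indicator A t \<partial>M)"
      using fin by (intro nn_integral_cong_AE) (auto simp: h_def indicator_def ennreal_enn2real_if elim!: eventually_mono)
    with f_int[OF A] have "(\<integral>\<^sup>+ t. ennreal (indicator A t * h t) \<partial>M) = ennreal (\<nu> A)" by simp
    then show ?thesis
      by (rule iffD1[OF nn_integral_eq_integrable, rotated -1])
        (auto simp: h_def \<nu>_nonneg)
  qed
  have h_integrable: "integrable M h"
    using h_int[of "space M"] by (simp cong: Bochner_Integration.integrable_cong)
  show ?thesis
  proof (intro exI[of _ "\<lambda>t. h t - \<bar>C\<bar>"] conjI ballI)
    show "integrable M (\<lambda>t. h t - \<bar>C\<bar>)" using h_integrable by simp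
    fix A assume A: "A \<in> sets M"
    have "(LINT t:A|M. h t - \<bar>C\<bar>) = (\<integral>t. indicator A t * h t - \<bar>C\<bar> * indicator A t \<partial>M)"
      unfolding set_lebesgue_integral_def by (simp add: algebra_simps)
    also have "\<dots> = (\<integral>t. indicator A t * h t \<partial>M) - (\<integral>t. \<bar>C\<bar> * indicator A t \<partial>M)"
      using h_int[OF A] A by (intro Bochner_Integration.integral_diff) (auto simp: emeasure_eq_measure)
    also have "\<dots> = \<phi> A"
      using h_int[OF A] A by (simp add: \<nu>_def)
    finally show "(LINT t:A|M. h t - \<bar>C\<bar>) = \<phi> A" .
  qed
qed

lemma countable_dense_complex: obtains D :: "complex set" where "countable D" "closure D = UNIV"
  using separable[of "UNIV :: complex set"] by (metis top.extremum_unique)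

text \<open>The disc of radius \<open>C\<close> is an intersection of half-planes, countably many of
  which suffice, so it is enough to treat one half-plane.\<close>

lemma (in finite_measure) AE_norm_le_of_set_integral_le:
  fixes g :: "'a \<Rightarrow> complex"
  assumes g: "integrable M g" and C: "0 \<le> C"
    and le: "\<And>A. A \<in> sets M \<Longrightarrow> cmod (LINT t:A|M. g t) \<le> C * measure M A"
  shows "AE t in M. cmod (g t) \<le> C"
proof -
  have half_plane: "AE t in M. Re (w * g t) \<le> C * cmod w" for w
  proof -
    \<comment> \<open>Where the half-plane condition fails the integrand is positive, yet the
      hypothesis makes its integral at most 0.\<close>
    define A where "A = {t \<in> space M. C * cmod w < Re (w * g t)}"
    have [measurable]: "g \<in> borel_measurable M" using g by simp
    have A [measurable]: "A \<in> sets M" unfolding A_def by measurable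
    have gA: "integrable M (\<lambda>t. indicator A t *\<^sub>R g t)"
      by (rule integrable_mult_indicator[OF A g])
    have wg: "integrable M (\<lambda>t. w * (indicator A t *\<^sub>R g t))"
      by (rule integrable_mult_right) (rule gA)
    have eq: "(\<lambda>t. indicator A t * (Re (w * g t) - C * cmod w))
        = (\<lambda>t. Re (w * (indicator A t *\<^sub>R g t)) - C * cmod w * indicator A t)"
      by (auto simp: indicator_def)
    have int: "integrable M (\<lambda>t. indicator A t * (Re (w * g t) - C * cmod w))"
      unfolding eq by (intro Bochner_Integration.integrable_diff integrable_Re[OF wg] integrable_mult_right)
        (auto simp: emeasure_eq_measure)
    have "(\<integral>t. indicator A t * (Re (w * g t) - C * cmod w) \<partial>M)
        = (\<integral>t. Re (w * (indicator A t *\<^sub>R g t)) \<partial>M) - (\<integral>t. C * cmod w * indicator A t \<partial>M)"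
      unfolding eq by (intro Bochner_Integration.integral_diff integrable_Re[OF wg])
        (auto simp: emeasure_eq_measure)
    also have "(\<integral>t. C * cmod w * indicator A t \<partial>M) = C * cmod w * measure M A"
      by simp
    also have "(\<integral>t. Re (w * (indicator A t *\<^sub>R g t)) \<partial>M) = Re (w * (LINT t:A|M. g t))"
      unfolding integral_Re[OF wg] set_lebesgue_integral_def by (subst integral_mult_right_zero) (rule refl)
    also have "Re (w * (LINT t:A|M. g t)) \<le> cmod w * (C * measure M A)"
      by (rule order_trans[OF complex_Re_le_cmod]) (simp add: norm_mult le[OF A] mult_left_mono)
    finally have "(\<integral>t. indicator A t * (Re (w * g t) - C * cmod w) \<partial>M) \<le> 0" by simp
    moreover have nonneg: "0 \<le> indicator A t * (Re (w * g t) - C * cmod w)" for t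
      by (auto simp: indicator_def A_def)
    then have "0 \<le> (\<integral>t. indicator A t * (Re (w * g t) - C * cmod w) \<partial>M)"
      by (intro Bochner_Integration.integral_nonneg)
    ultimately have "AE t in M. indicator A t * (Re (w * g t) - C * cmod w) = 0"
      using integral_nonneg_eq_0_iff_AE[OF int] nonneg by (simp del: mult_eq_0_iff)
    with AE_space show ?thesis
      by eventually_elim (auto simp: A_def indicator_def split: if_splits simp del: times_complex.sel)
  qed
  obtain D :: "complex set" where D: "countable D" "closure D = UNIV"
    by (rule countable_dense_complex)
  have "AE t in M. \<forall>w\<in>D. Re (w * g t) \<le> C * cmod w"
    using half_plane by (intro AE_ball_countable' D(1))
  then show ?thesis
  proof eventually_elim
    fix t assume "\<forall>w\<in>D. Re (w * g t) \<le> C * cmod w"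
    then have "D \<subseteq> {w. Re (w * g t) \<le> C * cmod w}" by blast
    moreover have "closed {w. Re (w * g t) \<le> C * cmod w}"
      by (intro closed_Collect_le continuous_intros)
    ultimately have "closure D \<subseteq> {w. Re (w * g t) \<le> C * cmod w}" by (rule closure_minimal)
    \<comment> \<open>The direction \<open>cnj (g t)\<close> recovers the modulus; density makes it
      available.\<close>
    with D(2) have "Re (cnj (g t) * g t) \<le> C * cmod (cnj (g t))" by blast
    then have "cmod (g t) * cmod (g t) \<le> C * cmod (g t)"
      using cmod_power2[of "g t"] by (simp add: power2_eq_square)
    then show "cmod (g t) \<le> C"
      by (cases "g t = 0") (use C in auto)
  qed
qed

lemma set_integrable_of_integrable:
  fixes f :: "'a \<Rightarrow> 'b::{banach, second_countable_topology}"
  shows "integrable M f \<Longrightarrow> A \<in> sets M \<Longrightarrow> set_integrable M A f"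
  unfolding set_integrable_def by (rule integrable_mult_indicator)

lemma (in finite_measure) norm_set_integral_le:
  fixes f :: "'a \<Rightarrow> 'b::{banach, second_countable_topology}"
  assumes f: "integrable M f" "AE t in M. norm (f t) \<le> K" and A: "A \<in> sets M"
  shows "norm (LINT t:A|M. f t) \<le> K * measure M A"
proof -
  have "norm (LINT t:A|M. f t) \<le> (\<integral>t. norm (indicator A t *\<^sub>R f t) \<partial>M)"
    unfolding set_lebesgue_integral_def by (rule integral_norm_bound)
  also have "\<dots> \<le> (\<integral>t. K * indicator A t \<partial>M)"
  proof (rule integral_mono_AE)
    show "integrable M (\<lambda>t. norm (indicator A t *\<^sub>R f t))"
      by (intro integrable_norm integrable_mult_indicator f A)
    show "integrable M (\<lambda>t. K * indicator A t)"
      using A by (auto simp: emeasure_eq_measure)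
    show "AE t in M. norm (indicator A t *\<^sub>R f t) \<le> K * indicator A t"
      using f(2) by eventually_elim (auto simp: indicator_def)
  qed
  also have "\<dots> = K * measure M A" using A by simp
  finally show ?thesis .
qed

text \<open>Real and imaginary parts have densities separately. The essential bound is then taken
  from the complex density as a whole, so the constant \<open>C\<close> is not worsened.\<close>

lemma linf_density:
  fixes \<phi> :: "real set \<Rightarrow> complex"
  assumes add: "\<And>A B. A \<in> sets unit_measure \<Longrightarrow> B \<in> sets unit_measure \<Longrightarrow> A \<inter> B = {} \<Longrightarrow>
      \<phi> (A \<union> B) = \<phi> A + \<phi> B"
    and C: "0 \<le> C" and bound: "\<And>A. A \<in> sets unit_measure \<Longrightarrow> cmod (\<phi> A) \<le> C * measure unit_measure A"
  shows "\<exists>F. norm F \<le> C \<and> (\<forall>A\<in>sets unit_measure. (LINT t:A|unit_measure. rep_linf F t) = \<phi> A)"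
proof -
  have "\<exists>g. integrable unit_measure g \<and> (\<forall>A\<in>sets unit_measure. (LINT t:A|unit_measure. g t) = Re (\<phi> A))"
    by (rule unit.bounded_additive_real_density[where C = C])
      (simp_all add: add order_trans[OF abs_Re_le_cmod bound])
  then obtain g1 where g1: "integrable unit_measure g1"
    "\<And>A. A \<in> sets unit_measure \<Longrightarrow> (LINT t:A|unit_measure. g1 t) = Re (\<phi> A)" by blast
  have "\<exists>g. integrable unit_measure g \<and> (\<forall>A\<in>sets unit_measure. (LINT t:A|unit_measure. g t) = Im (\<phi> A))"
    by (rule unit.bounded_additive_real_density[where C = C])
      (simp_all add: add order_trans[OF abs_Im_le_cmod bound])
  then obtain g2 where g2: "integrable unit_measure g2"
    "\<And>A. A \<in> sets unit_measure \<Longrightarrow> (LINT t:A|unit_measure. g2 t) = Im (\<phi> A)" by blast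
  define g where "g t = complex_of_real (g1 t) + \<i> * complex_of_real (g2 t)" for t
  have g: "integrable unit_measure g"
    unfolding g_def using g1(1) g2(1) by (intro Bochner_Integration.integrable_add integrable_mult_right integrable_of_real)
  have g_int: "(LINT t:A|unit_measure. g t) = \<phi> A" if A: "A \<in> sets unit_measure" for A
  proof -
    have i: "set_integrable unit_measure A (\<lambda>t. complex_of_real (g1 t))"
      "set_integrable unit_measure A (\<lambda>t. \<i> * complex_of_real (g2 t))"
      using g1(1) g2(1) A by (intro set_integrable_of_integrable integrable_mult_right integrable_of_real; simp)+
    have "(LINT t:A|unit_measure. g t) = complex_of_real (Re (\<phi> A)) + \<i> * complex_of_real (Im (\<phi> A))"
      unfolding g_def set_integral_add(2)[OF i] set_integral_mult_right set_integral_complex_of_real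
      using g1(2)[OF A] g2(2)[OF A] by simp
    then show ?thesis by (metis complex_eq)
  qed
  have AE: "AE t in unit_measure. cmod (g t) \<le> C"
    by (rule unit.AE_norm_le_of_set_integral_le[OF g C]) (simp add: g_int bound)
  with g have "ess_bounded g"
    by (auto simp: ess_bounded_iff)
  then have rep: "AE t in unit_measure. rep_linf (abs_linf g) t = g t"
    by (rule rep_abs_linf)
  show ?thesis
  proof (intro exI[of _ "abs_linf g"] conjI ballI)
    show "norm (abs_linf g) \<le> C"
      by (rule norm_linf_le) (use rep AE in \<open>eventually_elim, simp\<close>)
    fix A assume A: "A \<in> sets unit_measure"
    have "(LINT t:A|unit_measure. rep_linf (abs_linf g) t) = (LINT t:A|unit_measure. g t)"
      unfolding set_lebesgue_integral_def
      using rep A g by (intro integral_cong_AE) (auto elim: eventually_mono)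
    with g_int[OF A] show "(LINT t:A|unit_measure. rep_linf (abs_linf g) t) = \<phi> A" by simp
  qed
qed

section \<open>Set integrals of elements of \<open>linf\<close>\<close>

lemma set_integral_rep_linf_plus:
  assumes "A \<in> sets unit_measure"
  shows "(LINT t:A|unit_measure. rep_linf (F + G) t)
    = (LINT t:A|unit_measure. rep_linf F t) + (LINT t:A|unit_measure. rep_linf G t)"
proof -
  have "(LINT t:A|unit_measure. rep_linf (F + G) t) = (LINT t:A|unit_measure. rep_linf F t + rep_linf G t)"
    unfolding set_lebesgue_integral_def using assms rep_linf_plus[of F G]
    by (intro integral_cong_AE) (auto elim: eventually_mono)
  then show ?thesis
    using assms by (simp add: set_integral_add set_integrable_of_integrable rep_linf_integrable)
qed

lemma set_integral_rep_linf_scaleC: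
  assumes "A \<in> sets unit_measure"
  shows "(LINT t:A|unit_measure. rep_linf (a *\<^sub>C F) t) = a * (LINT t:A|unit_measure. rep_linf F t)"
proof -
  have "(LINT t:A|unit_measure. rep_linf (a *\<^sub>C F) t) = (LINT t:A|unit_measure. a * rep_linf F t)"
    unfolding set_lebesgue_integral_def using assms rep_linf_scaleC[of a F]
    by (intro integral_cong_AE) (auto elim: eventually_mono)
  then show ?thesis by simp
qed

text \<open>The half-plane bound with constant 0, applied to the difference.\<close>

lemma linf_eqI_set_integral:
  assumes "\<And>A. A \<in> sets unit_measure \<Longrightarrow>
    (LINT t:A|unit_measure. rep_linf F t) = (LINT t:A|unit_measure. rep_linf G t)"
  shows "F = G"
proof -
  have "AE t in unit_measure. cmod (rep_linf F t - rep_linf G t) \<le> 0"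
  proof (rule unit.AE_norm_le_of_set_integral_le)
    show "integrable unit_measure (\<lambda>t. rep_linf F t - rep_linf G t)"
      by (intro Bochner_Integration.integrable_diff rep_linf_integrable)
    show "cmod (LINT t:A|unit_measure. rep_linf F t - rep_linf G t) \<le> 0 * measure unit_measure A"
      if "A \<in> sets unit_measure" for A
      using that assms by (simp add: set_integral_diff set_integrable_of_integrable rep_linf_integrable)
  qed simp
  then show ?thesis by (intro linf_eqI) (auto elim: eventually_mono)
qed

text \<open>A Dynkin argument: initial segments are stable under intersection and generate the Borel
  sets.\<close>

lemma set_integral_unit_eq_0:
  fixes f :: "real \<Rightarrow> complex"
  assumes f: "integrable unit_measure f"
    and 0: "\<And>x. (LINT t:{0..1} \<inter> {..x}|unit_measure. f t) = 0"
    and A: "A \<in> sets unit_measure"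
  shows "(LINT t:A|unit_measure. f t) = 0"
proof -
  have meas: "{0..1} \<inter> S \<in> sets unit_measure" if "S \<in> sets borel" for S
  proof -
    from that have "S \<in> sets lebesgue" by simp
    then show ?thesis by (auto simp: sets_restrict_space)
  qed
  have int: "set_integrable unit_measure S f" if "S \<in> sets unit_measure" for S
    using that f by (rule set_integrable_of_integrable[rotated])
  have full: "(LINT t:{0..1}|unit_measure. f t) = 0"
    using 0[of 1] by (simp add: Int_absorb2)
  have borel: "(LINT t:{0..1} \<inter> S|unit_measure. f t) = 0" if "S \<in> sets borel" for S :: "real set"
  proof -
    have "Int_stable (range (\<lambda>x :: real. {..x}))"
      by (auto simp: Int_stable_def)
    moreover have "range (\<lambda>x :: real. {..x}) \<subseteq> Pow UNIV" by simp
    moreover have "S \<in> sigma_sets UNIV (range (\<lambda>x :: real. {..x}))"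
      using that by (simp add: borel_eq_atMost)
    ultimately show ?thesis
    proof (induction rule: sigma_sets_induct_disjoint)
      case (basic S)
      then show ?case using 0 by auto
    next
      case empty
      then show ?case by (simp add: set_lebesgue_integral_def)
    next
      case (compl S)
      then have S: "S \<in> sets borel" by (simp add: borel_eq_atMost)
      have "{0..1} = ({0..1} \<inter> S) \<union> ({0..1} \<inter> (UNIV - S))" by auto
      then have "(LINT t:{0..1}|unit_measure. f t)
          = (LINT t:({0..1} \<inter> S) \<union> ({0..1} \<inter> (UNIV - S))|unit_measure. f t)" by simp
      also have "\<dots> = (LINT t:{0..1} \<inter> S|unit_measure. f t) + (LINT t:{0..1} \<inter> (UNIV - S)|unit_measure. f t)"
        using S by (intro set_integral_Un int meas) auto
      finally show ?case using compl full by simp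
    next
      case (union S)
      then have S: "S i \<in> sets borel" for i by (auto simp: borel_eq_atMost)
      have "(LINT t:(\<Union>i. {0..1} \<inter> S i)|unit_measure. f t) = (\<Sum>i. LINT t:{0..1} \<inter> S i|unit_measure. f t)"
        using S union(1)
        by (intro lebesgue_integral_countable_add meas int sets.countable_UN) (auto simp: disjoint_family_on_def meas)
      then show ?case using union by simp
    qed
  qed
  \<comment> \<open>A Lebesgue set is a Borel set together with part of a null set, which the
    integral does not see.\<close>
  have "A \<in> sets (completion lborel)" "A \<subseteq> {0..1}"
    using A by (auto simp: sets_restrict_space)
  then obtain S N N' where A_eq: "A = S \<union> N" and S: "S \<in> sets borel" and N: "N \<subseteq> N'" "N' \<in> null_sets lborel"
    by (metis sets_completionE sets_lborel)
  have "AE t in lborel. t \<notin> N'" using N(2) by (rule AE_not_in)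
  then have "AE t in lebesgue. t \<notin> N'" by (rule AE_completion)
  then have "AE t in unit_measure. t \<notin> N'" by (simp add: AE_restrict_space_iff eventually_mono)
  then have "AE t in unit_measure. indicator A t *\<^sub>R f t = indicator ({0..1} \<inter> S) t *\<^sub>R f t"
    by eventually_elim (use N(1) \<open>A \<subseteq> {0..1}\<close> in \<open>auto simp: A_eq indicator_def\<close>)
  then have "(LINT t:A|unit_measure. f t) = (LINT t:{0..1} \<inter> S|unit_measure. f t)"
    unfolding set_lebesgue_integral_def
    by (intro integral_cong_AE borel_measurable_integrable integrable_mult_indicator f A meas S)
  with borel[OF S] show ?thesis by simp
qed

section \<open>Cell averages and their limits\<close>

text \<open>One ultrafilter is fixed for all sequences, so that limits exist for every bounded
  sequence and depend linearly on it.\<close>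

definition free_ultrafilter :: "nat filter" where
  "free_ultrafilter = (SOME U. is_ultrafilter U \<and> U \<le> sequentially)"

lemma free_ultrafilter: "is_ultrafilter free_ultrafilter" "free_ultrafilter \<le> sequentially"
proof -
  have "\<exists>U. is_ultrafilter U \<and> U \<le> sequentially"
    using ultrafilter_refinement[OF sequentially_bot] by blast
  from someI_ex[OF this] show "is_ultrafilter free_ultrafilter" "free_ultrafilter \<le> sequentially"
    by (simp_all add: free_ultrafilter_def)
qed

lemma free_ultrafilter_not_bot [simp]: "free_ultrafilter \<noteq> bot"
  using free_ultrafilter(1) by (simp add: is_ultrafilter_def)

lemma tendsto_Lim_free_ultrafilter:
  fixes a :: "nat \<Rightarrow> complex"
  assumes "\<And>k. cmod (a k) \<le> K"
  shows "(a \<longlongrightarrow> Lim free_ultrafilter a) free_ultrafilter"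
proof -
  obtain l where "(a \<longlongrightarrow> l) free_ultrafilter"
    using ultrafilter_tendsto_bounded[OF free_ultrafilter(1) assms] .
  then show ?thesis using tendsto_Lim[of free_ultrafilter a l] by simp
qed

text \<open>The sequence \<open>a\<close> encodes an array: on \<open>cell k j\<close> the
  \<open>k\<close>-th step function has the value stored at the code of \<open>(k, j)\<close>. One
  orthonormal sequence thus serves all partitions.\<close>

definition step_function :: "(nat \<Rightarrow> complex) \<Rightarrow> nat \<Rightarrow> real \<Rightarrow> complex" where
  "step_function a k t = a (prod_encode (k, nat \<lfloor>t * Suc k\<rfloor>))"

lemma step_function_measurable [measurable]: "step_function a k \<in> borel_measurable unit_measure"
proof -
  have "step_function a k \<in> borel_measurable borel" unfolding step_function_def by measurable
  then have "step_function a k \<in> borel_measurable lborel" by simp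
  then have "step_function a k \<in> borel_measurable lebesgue" by (rule measurable_completion)
  then show ?thesis by (rule measurable_restrict_space1)
qed

lemma step_function_integrable:
  assumes "\<And>m. cmod (a m) \<le> K"
  shows "integrable unit_measure (step_function a k)"
  by (rule unit.integrable_const_bound[where B = K]) (use assms in \<open>auto simp: step_function_def\<close>)

text \<open>The limit preserves finite additivity; countable additivity comes from the bound by the
  measure.\<close>

definition limit_charge :: "(nat \<Rightarrow> complex) \<Rightarrow> real set \<Rightarrow> complex" where
  "limit_charge a A = Lim free_ultrafilter (\<lambda>k. LINT t:A|unit_measure. step_function a k t)"

lemma norm_set_integral_step_function_le:
  assumes "\<And>m. cmod (a m) \<le> K" "A \<in> sets unit_measure"
  shows "cmod (LINT t:A|unit_measure. step_function a k t) \<le> K * measure unit_measure A"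
  by (rule unit.norm_set_integral_le[OF step_function_integrable[of a, OF assms(1)] _ assms(2)])
    (simp add: step_function_def assms(1))

lemma limit_charge_tendsto:
  assumes "\<And>m. cmod (a m) \<le> K" "A \<in> sets unit_measure"
  shows "((\<lambda>k. LINT t:A|unit_measure. step_function a k t) \<longlongrightarrow> limit_charge a A) free_ultrafilter"
  unfolding limit_charge_def
  by (rule tendsto_Lim_free_ultrafilter) (rule norm_set_integral_step_function_le[OF assms])

lemma limit_charge_eqI:
  assumes "((\<lambda>k. LINT t:A|unit_measure. step_function a k t) \<longlongrightarrow> l) free_ultrafilter"
  shows "limit_charge a A = l"
  unfolding limit_charge_def by (rule tendsto_Lim[OF free_ultrafilter_not_bot assms])

lemma norm_limit_charge_le:
  assumes "\<And>m. cmod (a m) \<le> K" "A \<in> sets unit_measure"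
  shows "cmod (limit_charge a A) \<le> K * measure unit_measure A"
proof (rule tendsto_upperbound)
  show "((\<lambda>k. cmod (LINT t:A|unit_measure. step_function a k t)) \<longlongrightarrow> cmod (limit_charge a A)) free_ultrafilter"
    by (rule tendsto_norm[OF limit_charge_tendsto[of a, OF assms]])
qed (use norm_set_integral_step_function_le[OF assms] in auto)

text \<open>The weak* limit of the step functions.\<close>

definition step_limit :: "(nat \<Rightarrow> complex) \<Rightarrow> linf" where
  "step_limit a = (SOME F. \<forall>A\<in>sets unit_measure. (LINT t:A|unit_measure. rep_linf F t) = limit_charge a A)"

lemma step_limit:
  assumes a: "\<And>m. cmod (a m) \<le> K"
  shows set_integral_step_limit:
    "A \<in> sets unit_measure \<Longrightarrow> (LINT t:A|unit_measure. rep_linf (step_limit a) t) = limit_charge a A"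
    and norm_step_limit_le: "norm (step_limit a) \<le> K"
proof -
  have K: "0 \<le> K" using a[of 0] norm_ge_zero order_trans by blast
  have "\<exists>F. norm F \<le> K \<and> (\<forall>A\<in>sets unit_measure. (LINT t:A|unit_measure. rep_linf F t) = limit_charge a A)"
  proof (rule linf_density[OF _ K norm_limit_charge_le[of a, OF a]])
    fix A B assume AB: "A \<in> sets unit_measure" "B \<in> sets unit_measure" "A \<inter> B = {}"
    have "(LINT t:A \<union> B|unit_measure. step_function a k t)
        = (LINT t:A|unit_measure. step_function a k t) + (LINT t:B|unit_measure. step_function a k t)" for k
      using AB by (intro set_integral_Un set_integrable_of_integrable step_function_integrable[of a, OF a])
    then show "limit_charge a (A \<union> B) = limit_charge a A + limit_charge a B"
      by (intro limit_charge_eqI)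
        (simp add: tendsto_add[OF limit_charge_tendsto[of a, OF a AB(1)] limit_charge_tendsto[of a, OF a AB(2)]])
  qed
  then obtain F where F: "norm F \<le> K"
    "\<forall>A\<in>sets unit_measure. (LINT t:A|unit_measure. rep_linf F t) = limit_charge a A" by blast
  have *: "\<forall>A\<in>sets unit_measure. (LINT t:A|unit_measure. rep_linf (step_limit a) t) = limit_charge a A"
    unfolding step_limit_def by (rule someI) (rule F(2))
  then show "A \<in> sets unit_measure \<Longrightarrow> (LINT t:A|unit_measure. rep_linf (step_limit a) t) = limit_charge a A"
    by blast
  \<comment> \<open>Set integrals determine an element, so the chosen one inherits the norm bound of
    the witness.\<close>
  have "step_limit a = F" by (rule linf_eqI_set_integral) (use * F(2) in simp)
  with F(1) show "norm (step_limit a) \<le> K" by simp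
qed

lemma step_limit_add:
  assumes a: "\<And>m. cmod (a m) \<le> K" and b: "\<And>m. cmod (b m) \<le> L"
  shows "step_limit (\<lambda>m. a m + b m) = step_limit a + step_limit b"
proof (rule linf_eqI_set_integral)
  fix A assume A: "A \<in> sets unit_measure"
  have ab: "cmod (a m + b m) \<le> K + L" for m
    using a b by (intro norm_triangle_le add_mono)
  have "(LINT t:A|unit_measure. step_function (\<lambda>m. a m + b m) k t)
      = (LINT t:A|unit_measure. step_function a k t) + (LINT t:A|unit_measure. step_function b k t)" for k
    using set_integral_add(2)[of unit_measure A "step_function a k" "step_function b k"] A
      step_function_integrable[of a, OF a] step_function_integrable[of b, OF b]
    by (simp add: set_integrable_of_integrable step_function_def[abs_def])
  then have "limit_charge (\<lambda>m. a m + b m) A = limit_charge a A + limit_charge b A"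
    by (intro limit_charge_eqI)
      (simp add: tendsto_add[OF limit_charge_tendsto[of a, OF a A] limit_charge_tendsto[of b, OF b A]])
  then show "(LINT t:A|unit_measure. rep_linf (step_limit (\<lambda>m. a m + b m)) t)
      = (LINT t:A|unit_measure. rep_linf (step_limit a + step_limit b) t)"
    using A by (simp add: set_integral_step_limit[of a, OF a] set_integral_step_limit[of b, OF b]
        set_integral_step_limit[of "\<lambda>m. a m + b m", OF ab] set_integral_rep_linf_plus)
qed

lemma step_limit_scaleC:
  assumes a: "\<And>m. cmod (a m) \<le> K"
  shows "step_limit (\<lambda>m. c * a m) = c *\<^sub>C step_limit a"
proof (rule linf_eqI_set_integral)
  fix A assume A: "A \<in> sets unit_measure"
  have ca: "cmod (c * a m) \<le> cmod c * K" for m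
    using a by (simp add: norm_mult mult_left_mono)
  have "(LINT t:A|unit_measure. step_function (\<lambda>m. c * a m) k t)
      = c * (LINT t:A|unit_measure. step_function a k t)" for k
    unfolding step_function_def by (rule set_integral_mult_right)
  then have "limit_charge (\<lambda>m. c * a m) A = c * limit_charge a A"
    by (intro limit_charge_eqI) (simp add: tendsto_mult_left[OF limit_charge_tendsto[of a, OF a A]])
  then show "(LINT t:A|unit_measure. rep_linf (step_limit (\<lambda>m. c * a m)) t)
      = (LINT t:A|unit_measure. rep_linf (c *\<^sub>C step_limit a) t)"
    using A by (simp add: set_integral_step_limit[of a, OF a]
        set_integral_step_limit[of "\<lambda>m. c * a m", OF ca] set_integral_rep_linf_scaleC)
qed

text \<open>On cells of measure zero the division by zero yields 0, which is compatible with
  linearity and the norm bound.\<close>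

definition cell_average :: "linf \<Rightarrow> nat \<Rightarrow> complex" where
  "cell_average F m = (case prod_decode m of (k, j) \<Rightarrow>
     (LINT t:cell k j|unit_measure. rep_linf F t) / complex_of_real (measure unit_measure (cell k j)))"

lemma norm_cell_average_le: "cmod (cell_average F m) \<le> norm F"
proof -
  obtain k j where m: "prod_decode m = (k, j)" by (rule prod.exhaust)
  have "cmod (LINT t:cell k j|unit_measure. rep_linf F t) \<le> norm F * measure unit_measure (cell k j)"
    by (intro unit.norm_set_integral_le rep_linf_integrable AE_rep_linf_le cell_measurable)
  then show ?thesis
    by (cases "measure unit_measure (cell k j) = 0")
      (simp_all add: cell_average_def m norm_divide zero_less_measure_iff divide_le_eq)
qed

lemma cell_average_add: "cell_average (F + G) m = cell_average F m + cell_average G m"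
  by (simp add: cell_average_def set_integral_rep_linf_plus add_divide_distrib split: prod.split)

lemma cell_average_scaleC: "cell_average (a *\<^sub>C F) m = a * cell_average F m"
  by (simp add: cell_average_def set_integral_rep_linf_scaleC split: prod.split)

lemma set_integral_step_function_cell_average:
  "(LINT t:cell k j|unit_measure. step_function (cell_average F) k t)
    = (LINT t:cell k j|unit_measure. rep_linf F t)"
proof -
  have "(LINT t:cell k j|unit_measure. step_function (cell_average F) k t)
      = (LINT t:cell k j|unit_measure. cell_average F (prod_encode (k, j)))"
    by (rule set_lebesgue_integral_cong[OF cell_measurable]) (auto simp: step_function_def cell_def)
  also have "\<dots> = complex_of_real (measure unit_measure (cell k j \<inter> {0..1})) * cell_average F (prod_encode (k, j))"
    by (simp add: set_lebesgue_integral_def scaleR_conv_of_real)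
  also have "cell k j \<inter> {0..1} = cell k j"
    by (auto simp: cell_def)
  \<comment> \<open>On a null cell both sides vanish, the right one by the bound on set
    integrals.\<close>
  also have "complex_of_real (measure unit_measure (cell k j)) * cell_average F (prod_encode (k, j))
      = (LINT t:cell k j|unit_measure. rep_linf F t)"
    using unit.norm_set_integral_le[OF rep_linf_integrable AE_rep_linf_le, of "cell k j" F]
    by (auto simp: cell_average_def)
  finally show ?thesis .
qed

text \<open>Averaging changes no integral over a full cell, so the error on an initial segment comes
  from one cut cell, of measure at most \<open>1 / Suc k\<close>.\<close>

lemma set_integral_step_function_cell_average_tendsto:
  "(\<lambda>k. LINT t:{0..1} \<inter> {..x}|unit_measure. step_function (cell_average F) k t)
    \<longlonglongrightarrow> (LINT t:{0..1} \<inter> {..x}|unit_measure. rep_linf F t)"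
proof -
  define g where "g k t = step_function (cell_average F) k t - rep_linf F t" for k t
  have int_step: "integrable unit_measure (step_function (cell_average F) k)" for k
    by (rule step_function_integrable) (rule norm_cell_average_le)
  have g: "integrable unit_measure (g k)" for k
    unfolding g_def by (intro Bochner_Integration.integrable_diff int_step rep_linf_integrable)
  have g_set: "set_integrable unit_measure S (g k)" if "S \<in> sets unit_measure" for S k
    using g that by (rule set_integrable_of_integrable)
  have g_eq: "(LINT t:S|unit_measure. g k t) = (LINT t:S|unit_measure. step_function (cell_average F) k t)
      - (LINT t:S|unit_measure. rep_linf F t)" if "S \<in> sets unit_measure" for S k
    unfolding g_def using that
    by (intro set_integral_diff set_integrable_of_integrable int_step rep_linf_integrable)
  have g_cell: "(LINT t:cell k j|unit_measure. g k t) = 0" for k j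
    by (simp add: g_eq set_integral_step_function_cell_average)
  have X: "{0..1} \<inter> {..x} \<in> sets unit_measure"
  proof -
    have "{0..1} \<inter> {..x} \<in> sets lebesgue" by simp
    then show ?thesis by (subst sets_restrict_space_iff) auto
  qed
  have le: "cmod (LINT t:{0..1} \<inter> {..x}|unit_measure. g k t) \<le> 2 * norm F / Suc k" for k
  proof -
    \<comment> \<open>For \<open>x\<close> in [0,1] this is the index of the cell containing
      \<open>x\<close>; \<open>L\<close> collects the full cells before it and \<open>R\<close> is
      the cut one.\<close>
    define p where "p = nat \<lfloor>x * Suc k\<rfloor>"
    define L where "L = (\<Union>j\<in>{..<p}. cell k j)"
    define R where "R = {0..1} \<inter> {..x} \<inter> cell k p"
    have sets: "L \<in> sets unit_measure" "R \<in> sets unit_measure"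
      unfolding L_def R_def using X by auto
    have "t \<le> x" if "0 \<le> t" "nat \<lfloor>t * Suc k\<rfloor> < p" for t :: real
    proof (rule ccontr)
      assume "\<not> t \<le> x"
      then have "\<lfloor>x * Suc k\<rfloor> \<le> \<lfloor>t * Suc k\<rfloor>" by (intro floor_mono mult_right_mono) auto
      with that show False by (simp add: p_def nat_mono leD)
    qed
    moreover have "nat \<lfloor>t * Suc k\<rfloor> \<le> p" if "t \<le> x" for t :: real
      unfolding p_def using that by (intro nat_mono floor_mono mult_right_mono) auto
    ultimately have split: "{0..1} \<inter> {..x} = L \<union> R" and disj: "L \<inter> R = {}"
      by (fastforce simp: L_def R_def cell_def)+
    have "(LINT t:L|unit_measure. g k t) = (\<Sum>j<p. LINT t:cell k j|unit_measure. g k t)"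
      unfolding L_def
    proof (rule set_integral_finite_Union)
      show "disjoint_family_on (cell k) {..<p}" by (auto simp: disjoint_family_on_def cell_def)
    qed (auto intro: g_set)
    then have "(LINT t:{0..1} \<inter> {..x}|unit_measure. g k t) = (LINT t:R|unit_measure. g k t)"
      unfolding split set_integral_Un[OF disj g_set[OF sets(1)] g_set[OF sets(2)]] by (simp add: g_cell)
    also have "cmod \<dots> \<le> 2 * norm F * measure unit_measure R"
    proof (rule unit.norm_set_integral_le[OF g _ sets(2)])
      have step: "cmod (step_function (cell_average F) k t) \<le> norm F" for t
        unfolding step_function_def by (rule norm_cell_average_le)
      from AE_rep_linf_le[of F] show "AE t in unit_measure. cmod (g k t) \<le> 2 * norm F"
      proof eventually_elim
        case (elim t)
        then show ?case
          unfolding g_def using step[of t] norm_triangle_ineq4[of "step_function (cell_average F) k t" "rep_linf F t"]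
          by linarith
      qed
    qed
    also have "\<dots> \<le> 2 * norm F * (1 / Suc k)"
    proof (intro mult_left_mono)
      have "measure unit_measure R \<le> measure unit_measure (cell k p)"
        unfolding R_def by (intro unit.finite_measure_mono) auto
      then show "measure unit_measure R \<le> 1 / Suc k" using measure_cell_le[of k p] by linarith
    qed simp
    finally show ?thesis by simp
  qed
  have "(\<lambda>k. 2 * norm F / Suc k) \<longlonglongrightarrow> 0"
    using LIMSEQ_Suc[OF lim_const_over_n[of "2 * norm F"]] by simp
  then have "(\<lambda>k. LINT t:{0..1} \<inter> {..x}|unit_measure. g k t) \<longlonglongrightarrow> 0"
    by (rule Lim_null_comparison[OF always_eventually, rotated]) (use le in simp)
  then show ?thesis unfolding g_eq[OF X] by (rule LIM_zero_cancel)
qed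

text \<open>Ordinary convergence on initial segments implies convergence along the finer
  ultrafilter, and initial segments determine all set integrals.\<close>

lemma step_limit_cell_average: "step_limit (cell_average F) = F"
proof (rule linf_eqI_set_integral)
  let ?G = "step_limit (cell_average F)"
  have int: "integrable unit_measure (\<lambda>t. rep_linf ?G t - rep_linf F t)"
    by (intro Bochner_Integration.integrable_diff rep_linf_integrable)
  have diff: "(LINT t:A|unit_measure. rep_linf ?G t - rep_linf F t)
      = (LINT t:A|unit_measure. rep_linf ?G t) - (LINT t:A|unit_measure. rep_linf F t)"
    if "A \<in> sets unit_measure" for A
    using that by (intro set_integral_diff set_integrable_of_integrable rep_linf_integrable)
  fix A assume A: "A \<in> sets unit_measure"
  have "(LINT t:A|unit_measure. rep_linf ?G t - rep_linf F t) = 0"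
  proof (rule set_integral_unit_eq_0[OF int _ A])
    fix x :: real
    have "{0..1} \<inter> {..x} \<in> sets lebesgue" by simp
    then have X: "{0..1} \<inter> {..x} \<in> sets unit_measure" by (subst sets_restrict_space_iff) auto
    have lc: "limit_charge (cell_average F) ({0..1} \<inter> {..x}) = (LINT t:{0..1} \<inter> {..x}|unit_measure. rep_linf F t)"
      by (intro limit_charge_eqI tendsto_mono[OF free_ultrafilter(2)]
          set_integral_step_function_cell_average_tendsto)
    show "(LINT t:{0..1} \<inter> {..x}|unit_measure. rep_linf ?G t - rep_linf F t) = 0"
      by (simp only: diff[OF X] set_integral_step_limit[of "cell_average F", OF norm_cell_average_le X]
          lc diff_self)
  qed
  with diff[OF A] show "(LINT t:A|unit_measure. rep_linf ?G t) = (LINT t:A|unit_measure. rep_linf F t)"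
    by simp
qed

section \<open>Matrix norms over $L_\infty[0,1]$\<close>

lemma cmod_bilinear_le:
  fixes v y :: "nat \<Rightarrow> complex"
  shows "cmod (\<Sum>i<n. y i * v i) \<le> vec_norm n v * vec_norm n y"
proof -
  have "cmod (\<Sum>i<n. y i * v i) \<le> (\<Sum>i<n. \<bar>cmod (y i)\<bar> * \<bar>cmod (v i)\<bar>)"
    by (rule order_trans[OF norm_sum]) (simp add: norm_mult)
  also have "\<dots> \<le> vec_norm n y * vec_norm n v" by (rule L2_set_mult_ineq)
  finally show ?thesis by (simp add: mult.commute)
qed

lemma vec_norm_le_dual:
  fixes v :: "nat \<Rightarrow> complex"
  assumes B: "0 \<le> B" and le: "\<And>y. cmod (\<Sum>i<n. y i * v i) \<le> B * vec_norm n y"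
  shows "vec_norm n v \<le> B"
proof (cases "vec_norm n v = 0")
  case False
  \<comment> \<open>The conjugate of \<open>v\<close> is the extremal test vector.\<close>
  have "(\<Sum>i<n. cnj (v i) * v i) = complex_of_real ((vec_norm n v)\<^sup>2)"
    unfolding vec_norm_squared of_real_sum complex_norm_square by (simp add: mult.commute)
  with le[of "\<lambda>i. cnj (v i)"] have "vec_norm n v * vec_norm n v \<le> B * vec_norm n v"
    by (simp add: norm_mult power2_eq_square)
  moreover have "0 < vec_norm n v" using False by (simp add: order_le_neq_trans)
  ultimately show ?thesis by simp
qed (use B in simp)

text \<open>Testing with bilinear forms turns the norm bound into scalar conditions, which can be
  restricted to countably many vectors and match the compressions.\<close>

lemma scalar_matrix_op_norm_le_iff:
  fixes G :: "nat \<Rightarrow> nat \<Rightarrow> complex"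
  assumes c: "0 \<le> c"
  shows "matrix_op_norm n (\<lambda>i j z. G i j * z) \<le> c \<longleftrightarrow>
    (\<forall>x y. cmod (\<Sum>i<n. y i * (\<Sum>j<n. G i j * x j)) \<le> c * vec_norm n x * vec_norm n y)"
proof
  assume le: "matrix_op_norm n (\<lambda>i j z. G i j * z) \<le> c"
  show "\<forall>x y. cmod (\<Sum>i<n. y i * (\<Sum>j<n. G i j * x j)) \<le> c * vec_norm n x * vec_norm n y"
  proof (intro allI)
    fix x y :: "nat \<Rightarrow> complex"
    have "vec_norm n (\<lambda>i. \<Sum>j<n. G i j * x j) \<le> matrix_op_norm n (\<lambda>i j z. G i j * z) * vec_norm n x"
      by (rule matrix_op_norm_bound) (rule bounded_linear_mult_right)
    also have "\<dots> \<le> c * vec_norm n x"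
      using le by (intro mult_right_mono L2_set_nonneg)
    finally have "vec_norm n (\<lambda>i. \<Sum>j<n. G i j * x j) * vec_norm n y \<le> c * vec_norm n x * vec_norm n y"
      by (intro mult_right_mono L2_set_nonneg)
    with cmod_bilinear_le[where n = n and y = y and v = "\<lambda>i. \<Sum>j<n. G i j * x j"]
    show "cmod (\<Sum>i<n. y i * (\<Sum>j<n. G i j * x j)) \<le> c * vec_norm n x * vec_norm n y"
      by linarith
  qed
next
  assume le: "\<forall>x y. cmod (\<Sum>i<n. y i * (\<Sum>j<n. G i j * x j)) \<le> c * vec_norm n x * vec_norm n y"
  show "matrix_op_norm n (\<lambda>i j z. G i j * z) \<le> c"
    by (rule matrix_op_norm_le[OF vec_norm_le_dual c]) (use le c in \<open>auto simp: L2_set_nonneg\<close>)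
qed

text \<open>Both sides are continuous in the first \<open>n\<close> coordinates. Extensional tuples
  are used because, for countable \<open>D\<close>, there are only countably many of them.\<close>

lemma matrix_form_le_dense:
  fixes G :: "nat \<Rightarrow> nat \<Rightarrow> complex"
  assumes D: "closure D = UNIV"
    and le: "\<forall>x\<in>{..<n} \<rightarrow>\<^sub>E D. \<forall>y\<in>{..<n} \<rightarrow>\<^sub>E D.
      cmod (\<Sum>i<n. y i * (\<Sum>j<n. G i j * x j)) \<le> c * vec_norm n x * vec_norm n y"
  shows "cmod (\<Sum>i<n. y i * (\<Sum>j<n. G i j * x j)) \<le> c * vec_norm n x * vec_norm n y"
proof -
  have approx: "\<exists>s. (\<forall>k. s k \<in> {..<n} \<rightarrow>\<^sub>E D) \<and> (\<forall>j<n. (\<lambda>k. s k j) \<longlonglongrightarrow> x j)" for x :: "nat \<Rightarrow> complex"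
  proof -
    have "\<exists>s. (\<forall>k. s k \<in> D) \<and> s \<longlonglongrightarrow> x j" for j
      using D closure_sequential[of "x j" D] by auto
    then obtain s where s: "\<And>j k. s j k \<in> D" "\<And>j. s j \<longlonglongrightarrow> x j" by metis
    show ?thesis
      by (rule exI[of _ "\<lambda>k. restrict (\<lambda>j. s j k) {..<n}"]) (use s in auto)
  qed
  obtain s where s: "\<And>k. s k \<in> {..<n} \<rightarrow>\<^sub>E D" "\<And>j. j < n \<Longrightarrow> (\<lambda>k. s k j) \<longlonglongrightarrow> x j"
    using approx[of x] by blast
  obtain r where r: "\<And>k. r k \<in> {..<n} \<rightarrow>\<^sub>E D" "\<And>j. j < n \<Longrightarrow> (\<lambda>k. r k j) \<longlonglongrightarrow> y j"
    using approx[of y] by blast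
  show ?thesis
  proof (rule LIMSEQ_le)
    show "(\<lambda>k. cmod (\<Sum>i<n. r k i * (\<Sum>j<n. G i j * s k j))) \<longlonglongrightarrow> cmod (\<Sum>i<n. y i * (\<Sum>j<n. G i j * x j))"
      by (intro tendsto_intros s(2) r(2)) auto
    show "(\<lambda>k. c * vec_norm n (s k) * vec_norm n (r k)) \<longlonglongrightarrow> c * vec_norm n x * vec_norm n y"
      unfolding L2_set_def by (intro tendsto_intros s(2) r(2)) auto
  qed (use le s(1) r(1) in blast)
qed

text \<open>The essential supremum in \<open>linf_matrix_norms\<close> has its usual meaning only
  for a measurable function; each sublevel set is cut out by countably many conditions.\<close>

lemma matrix_op_norm_rep_linf_measurable:
  "(\<lambda>t. matrix_op_norm n (\<lambda>i j z. rep_linf (F i j) t * z)) \<in> borel_measurable unit_measure"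
proof (subst borel_measurable_iff_le, rule allI)
  fix c :: real
  obtain D :: "complex set" where D: "countable D" "closure D = UNIV"
    by (rule countable_dense_complex)
  define X where "X = {..<n} \<rightarrow>\<^sub>E D"
  have X: "countable X" unfolding X_def using D(1) by (intro countable_PiE) auto
  have nonneg: "0 \<le> matrix_op_norm n (\<lambda>i j z. G i j * z)" for G :: "nat \<Rightarrow> nat \<Rightarrow> complex"
    by (rule matrix_op_norm_nonneg) (rule bounded_linear_mult_right)
  show "{t \<in> space unit_measure. matrix_op_norm n (\<lambda>i j z. rep_linf (F i j) t * z) \<le> c} \<in> sets unit_measure"
  proof (cases "0 \<le> c")
    case True
    have "matrix_op_norm n (\<lambda>i j z. rep_linf (F i j) t * z) \<le> c \<longleftrightarrow>
        (\<forall>x\<in>X. \<forall>y\<in>X. cmod (\<Sum>i<n. y i * (\<Sum>j<n. rep_linf (F i j) t * x j)) \<le> c * vec_norm n x * vec_norm n y)" for t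
      unfolding scalar_matrix_op_norm_le_iff[OF True]
      using matrix_form_le_dense[OF D(2), of n "\<lambda>i j. rep_linf (F i j) t" c] by (auto simp: X_def)
    moreover have "{t \<in> space unit_measure. \<forall>x\<in>X. \<forall>y\<in>X.
        cmod (\<Sum>i<n. y i * (\<Sum>j<n. rep_linf (F i j) t * x j)) \<le> c * vec_norm n x * vec_norm n y} \<in> sets unit_measure"
      using X by measurable
    ultimately show ?thesis by simp
  next
    case False
    then have "\<not> matrix_op_norm n (\<lambda>i j z. rep_linf (F i j) t * z) \<le> c" for t
      using nonneg[of "\<lambda>i j. rep_linf (F i j) t"] by linarith
    then show ?thesis by simp
  qed
qed

lemma rep_linf_compression:
  fixes x y :: "nat \<Rightarrow> complex"
  shows "AE t in unit_measure. rep_linf (\<Sum>i<n. \<Sum>j<n. (y i * x j) *\<^sub>C F i j) t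
    = (\<Sum>i<n. y i * (\<Sum>j<n. rep_linf (F i j) t * x j))"
proof -
  have "AE t in unit_measure. \<forall>i\<in>{..<n}. \<forall>j\<in>{..<n}. rep_linf ((y i * x j) *\<^sub>C F i j) t = y i * x j * rep_linf (F i j) t"
    by (intro AE_ball_countable' countable_finite finite_lessThan rep_linf_scaleC)
  moreover have "AE t in unit_measure. \<forall>i\<in>{..<n}. rep_linf (\<Sum>j<n. (y i * x j) *\<^sub>C F i j) t
      = (\<Sum>j<n. rep_linf ((y i * x j) *\<^sub>C F i j) t)"
    by (intro AE_ball_countable' countable_finite finite_lessThan rep_linf_sum)
  moreover have "AE t in unit_measure. rep_linf (\<Sum>i<n. \<Sum>j<n. (y i * x j) *\<^sub>C F i j) t
      = (\<Sum>i<n. rep_linf (\<Sum>j<n. (y i * x j) *\<^sub>C F i j) t)"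
    by (intro rep_linf_sum finite_lessThan)
  ultimately show ?thesis
    by eventually_elim (simp add: sum_distrib_left ac_simps)
qed

text \<open>The exceptional null set depends on \<open>x\<close> and \<open>y\<close>; with
  countably many test vectors these sets unite to a null set, and density gives the remaining
  vectors.\<close>

lemma AE_matrix_op_norm_le:
  assumes K: "0 \<le> K"
    and le: "\<And>x y. norm (\<Sum>i<n. \<Sum>j<n. (y i * x j) *\<^sub>C F i j) \<le> K * vec_norm n x * vec_norm n y"
  shows "AE t in unit_measure. matrix_op_norm n (\<lambda>i j z. rep_linf (F i j) t * z) \<le> K"
proof -
  obtain D :: "complex set" where D: "countable D" "closure D = UNIV"
    by (rule countable_dense_complex)
  define X where "X = {..<n} \<rightarrow>\<^sub>E D"
  have X: "countable X" unfolding X_def using D(1) by (intro countable_PiE) auto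
  have "AE t in unit_measure. cmod (\<Sum>i<n. y i * (\<Sum>j<n. rep_linf (F i j) t * x j))
      \<le> K * vec_norm n x * vec_norm n y" for x y
    using rep_linf_compression[where n = n and y = y and x = x and F = F] AE_rep_linf_le[of "\<Sum>i<n. \<Sum>j<n. (y i * x j) *\<^sub>C F i j"]
    by eventually_elim (use le[of y x] in simp)
  then have "AE t in unit_measure. \<forall>x\<in>X. \<forall>y\<in>X. cmod (\<Sum>i<n. y i * (\<Sum>j<n. rep_linf (F i j) t * x j))
      \<le> K * vec_norm n x * vec_norm n y"
    by (intro AE_ball_countable' X)
  then show ?thesis
  proof eventually_elim
    fix t
    assume "\<forall>x\<in>X. \<forall>y\<in>X. cmod (\<Sum>i<n. y i * (\<Sum>j<n. rep_linf (F i j) t * x j))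
      \<le> K * vec_norm n x * vec_norm n y"
    from matrix_form_le_dense[OF D(2) this[unfolded X_def]]
    show "matrix_op_norm n (\<lambda>i j z. rep_linf (F i j) t * z) \<le> K"
      unfolding scalar_matrix_op_norm_le_iff[OF K] by blast
  qed
qed

lemma linf_matrix_norms_le:
  assumes K: "0 \<le> K"
    and le: "\<And>x y. norm (\<Sum>i<n. \<Sum>j<n. (y i * x j) *\<^sub>C F i j) \<le> K * vec_norm n x * vec_norm n y"
  shows "linf_matrix_norms n F \<le> K"
proof -
  define E where "E = esssup unit_measure (\<lambda>t. ereal (matrix_op_norm n (\<lambda>i j z. rep_linf (F i j) t * z)))"
  have "E \<le> ereal K"
    unfolding E_def using AE_matrix_op_norm_le[OF K le] matrix_op_norm_rep_linf_measurable
    by (intro esssup_I) auto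
  with K show ?thesis
    unfolding linf_matrix_norms_def E_def[symmetric] by (cases E) auto
qed

text \<open>The crude bound by the sum of the norms of the entries shows that the essential supremum
  is finite, so that \<open>real_of_ereal\<close> loses nothing.\<close>

lemma AE_matrix_op_norm_le_linf_matrix_norms:
  "AE t in unit_measure. matrix_op_norm n (\<lambda>i j z. rep_linf (F i j) t * z) \<le> linf_matrix_norms n F"
proof -
  define E where "E = esssup unit_measure (\<lambda>t. ereal (matrix_op_norm n (\<lambda>i j z. rep_linf (F i j) t * z)))"
  define K where "K = (\<Sum>i<n. \<Sum>j<n. norm (F i j))"
  have K: "0 \<le> K" by (simp add: K_def sum_nonneg)
  have "norm (\<Sum>i<n. \<Sum>j<n. (y i * x j) *\<^sub>C F i j) \<le> K * vec_norm n x * vec_norm n y" for x y :: "nat \<Rightarrow> complex"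
  proof -
    have "norm (\<Sum>i<n. \<Sum>j<n. (y i * x j) *\<^sub>C F i j) \<le> (\<Sum>i<n. \<Sum>j<n. norm ((y i * x j) *\<^sub>C F i j))"
      by (rule order_trans[OF norm_sum sum_mono]) (rule norm_sum)
    also have "\<dots> \<le> (\<Sum>i<n. \<Sum>j<n. norm (F i j) * (vec_norm n x * vec_norm n y))"
    proof (intro sum_mono)
      fix i j assume "i \<in> {..<n}" "j \<in> {..<n}"
      then have "cmod (x j) * cmod (y i) \<le> vec_norm n x * vec_norm n y"
        by (intro mult_mono norm_le_vec_norm L2_set_nonneg) auto
      then have "norm (F i j) * (cmod (x j) * cmod (y i)) \<le> norm (F i j) * (vec_norm n x * vec_norm n y)"
        by (intro mult_left_mono) auto
      then show "norm ((y i * x j) *\<^sub>C F i j) \<le> norm (F i j) * (vec_norm n x * vec_norm n y)"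
        by (simp add: norm_scaleC norm_mult ac_simps)
    qed
    also have "\<dots> = K * vec_norm n x * vec_norm n y"
      by (simp add: K_def sum_distrib_right mult.assoc)
    finally show ?thesis .
  qed
  then have "E \<le> ereal K"
    unfolding E_def using AE_matrix_op_norm_le[OF K] matrix_op_norm_rep_linf_measurable
    by (intro esssup_I) auto
  then have "E \<noteq> \<infinity>" by auto
  moreover have "AE t in unit_measure. ereal (matrix_op_norm n (\<lambda>i j z. rep_linf (F i j) t * z)) \<le> E"
    unfolding E_def by (rule esssup_AE)
  ultimately show ?thesis
    unfolding linf_matrix_norms_def E_def[symmetric] by (cases E) (auto elim: eventually_mono)
qed

text \<open>Extracts a conclusion free of \<open>t\<close> from an almost-everywhere statement, as
  the measure is not zero.\<close>

lemma AE_unit_const: "(AE t in unit_measure. P) \<longleftrightarrow> P"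
proof -
  have "emeasure unit_measure (space unit_measure) \<noteq> 0"
    by (simp add: emeasure_restrict_space)
  then have "\<not> (AE t in unit_measure. False)"
    by (subst AE_iff_measurable[OF sets.top]) auto
  then show ?thesis by (cases P) auto
qed

lemma linf_matrix_norms_nonneg: "0 \<le> linf_matrix_norms n F"
proof -
  have "0 \<le> matrix_op_norm n (\<lambda>i j z. rep_linf (F i j) t * z)" for t
    by (rule matrix_op_norm_nonneg) (rule bounded_linear_mult_right)
  then have "AE t in unit_measure. 0 \<le> linf_matrix_norms n F"
    using AE_matrix_op_norm_le_linf_matrix_norms[of n F] by (auto elim!: eventually_mono intro: order_trans)
  then show ?thesis by (simp only: AE_unit_const)
qed

text \<open>Together with \<open>linf_matrix_norms_le\<close> this characterises the matrix norm as
  the least nonnegative bound for all scalar compressions.\<close>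

lemma norm_linf_compression_le:
  "norm (\<Sum>i<n. \<Sum>j<n. (y i * x j) *\<^sub>C F i j) \<le> linf_matrix_norms n F * vec_norm n x * vec_norm n y"
proof (rule norm_linf_le)
  show "AE t in unit_measure. cmod (rep_linf (\<Sum>i<n. \<Sum>j<n. (y i * x j) *\<^sub>C F i j) t)
      \<le> linf_matrix_norms n F * vec_norm n x * vec_norm n y"
    using rep_linf_compression[where n = n and y = y and x = x and F = F] AE_matrix_op_norm_le_linf_matrix_norms[of n F]
    by eventually_elim (simp add: scalar_matrix_op_norm_le_iff[OF linf_matrix_norms_nonneg])
qed

section \<open>The embedding of $L_\infty[0,1]$ and the expectation onto it\<close>

definition linf_embedding :: "(nat \<Rightarrow> 'h::complex_hilbert) \<Rightarrow> linf \<Rightarrow> 'h \<Rightarrow>\<^sub>L 'h" where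
  "linf_embedding e F = diagonal_operator e (cell_average F)"

definition linf_expectation :: "(nat \<Rightarrow> 'h::complex_hilbert) \<Rightarrow> ('h \<Rightarrow>\<^sub>L 'h) \<Rightarrow> linf" where
  "linf_expectation e T = step_limit (\<lambda>m. cinner (e m) (blinfun_apply T (e m)))"

context
  fixes e :: "nat \<Rightarrow> 'h::complex_hilbert"
  assumes e: "orthonormal e"
begin

lemma cmod_diagonal_entry_le: "cmod (cinner (e m) (blinfun_apply T (e m))) \<le> norm T"
  using cinner_Cauchy_Schwarz[of "e m" "blinfun_apply T (e m)"] norm_blinfun[of T "e m"]
  by (simp add: orthonormal_norm[OF e])

lemma linf_expectation_add: "linf_expectation e (S + T) = linf_expectation e S + linf_expectation e T"
  unfolding linf_expectation_def blinfun.add_left cinner_add_right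
  by (rule step_limit_add; rule cmod_diagonal_entry_le)

lemma linf_expectation_scaleC: "linf_expectation e (a *\<^sub>C T) = a *\<^sub>C linf_expectation e T"
  unfolding linf_expectation_def scaleC_blinfun.rep_eq cinner_scaleC_right
  by (rule step_limit_scaleC; rule cmod_diagonal_entry_le)

lemma linf_expectation_sum: "linf_expectation e (\<Sum>i\<in>I. T i) = (\<Sum>i\<in>I. linf_expectation e (T i))"
proof -
  have "linf_expectation e 0 = 0" using linf_expectation_add[of 0 0] by simp
  then show ?thesis
    by (induction I rule: infinite_finite_induct) (auto simp: linf_expectation_add)
qed

lemma norm_linf_expectation_le: "norm (linf_expectation e T) \<le> norm T"
  unfolding linf_expectation_def by (rule norm_step_limit_le) (rule cmod_diagonal_entry_le)

lemma linf_expectation_embedding: "linf_expectation e (linf_embedding e F) = F"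
  unfolding linf_expectation_def linf_embedding_def
    cinner_diagonal_operator[OF e, of "cell_average F", OF norm_cell_average_le]
  by (rule step_limit_cell_average)

lemma linf_embedding_bounded_operators: "linf_embedding e F \<in> bounded_operators"
  unfolding linf_embedding_def by (rule diagonal_operator_bounded_operators[OF e norm_cell_average_le])

lemma linf_embedding_add: "linf_embedding e (F + G) = linf_embedding e F + linf_embedding e G"
  unfolding linf_embedding_def cell_average_add[abs_def]
  by (rule diagonal_operator_add[OF e]; rule norm_cell_average_le)

lemma linf_embedding_scaleC: "linf_embedding e (a *\<^sub>C F) = a *\<^sub>C linf_embedding e F"
  unfolding linf_embedding_def cell_average_scaleC[abs_def]
  by (rule diagonal_operator_scaleC[OF e]; rule norm_cell_average_le)

text \<open>Each cell average is a contractive functional. Applied to the compressions it bounds, by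
  duality, the scalar matrix of averages belonging to every index \<open>m\<close>.\<close>

lemma linf_embedding_completely_contractive:
  "operator_matrix_norms n (\<lambda>i j. linf_embedding e (F i j)) \<le> linf_matrix_norms n F"
  unfolding linf_embedding_def
proof (rule operator_matrix_norms_diagonal_le[OF e linf_matrix_norms_nonneg])
  have sum: "cell_average (\<Sum>i\<in>I. G i) m = (\<Sum>i\<in>I. cell_average (G i) m)" for I m and G :: "nat \<Rightarrow> linf"
  proof -
    have "cell_average 0 m = 0" using cell_average_add[of 0 0 m] by simp
    then show ?thesis by (induction I rule: infinite_finite_induct) (auto simp: cell_average_add)
  qed
  fix m z
  show "vec_norm n (\<lambda>i. \<Sum>j<n. cell_average (F i j) m * z j) \<le> linf_matrix_norms n F * vec_norm n z"
  proof (rule vec_norm_le_dual)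
    fix y :: "nat \<Rightarrow> complex"
    have "(\<Sum>i<n. y i * (\<Sum>j<n. cell_average (F i j) m * z j))
        = cell_average (\<Sum>i<n. \<Sum>j<n. (y i * z j) *\<^sub>C F i j) m"
      by (simp add: sum cell_average_scaleC sum_distrib_left ac_simps)
    also have "cmod \<dots> \<le> norm (\<Sum>i<n. \<Sum>j<n. (y i * z j) *\<^sub>C F i j)"
      by (rule norm_cell_average_le)
    also have "\<dots> \<le> linf_matrix_norms n F * vec_norm n z * vec_norm n y"
      by (rule norm_linf_compression_le)
    finally show "cmod (\<Sum>i<n. y i * (\<Sum>j<n. cell_average (F i j) m * z j))
        \<le> linf_matrix_norms n F * vec_norm n z * vec_norm n y" .
  qed (simp add: linf_matrix_norms_nonneg L2_set_nonneg)
qed (use norm_cell_average_le in blast)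

text \<open>The expectation commutes with scalar compressions, so its plain contractivity is
  enough.\<close>

lemma linf_expectation_completely_contractive:
  assumes "\<And>i j. i < n \<Longrightarrow> j < n \<Longrightarrow> T i j \<in> bounded_operators"
  shows "linf_matrix_norms n (\<lambda>i j. linf_expectation e (T i j)) \<le> operator_matrix_norms n T"
proof (rule linf_matrix_norms_le)
  show "0 \<le> operator_matrix_norms n T"
    unfolding operator_matrix_norms_def by (rule matrix_op_norm_nonneg) (rule blinfun.bounded_linear_right)
  fix x y :: "nat \<Rightarrow> complex"
  have "(\<Sum>i<n. \<Sum>j<n. (y i * x j) *\<^sub>C linf_expectation e (T i j))
      = linf_expectation e (\<Sum>i<n. \<Sum>j<n. (y i * x j) *\<^sub>C T i j)"
    by (simp add: linf_expectation_sum linf_expectation_scaleC)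
  also have "norm \<dots> \<le> norm (\<Sum>i<n. \<Sum>j<n. (y i * x j) *\<^sub>C T i j)"
    by (rule norm_linf_expectation_le)
  also have "\<dots> \<le> operator_matrix_norms n T * vec_norm n x * vec_norm n y"
    by (rule norm_matrix_compression_le[OF assms])
  finally show "norm (\<Sum>i<n. \<Sum>j<n. (y i * x j) *\<^sub>C linf_expectation e (T i j))
      \<le> operator_matrix_norms n T * vec_norm n x * vec_norm n y" .
qed

text \<open>The expectation is a completely contractive left inverse of the completely contractive
  embedding, so no norm can drop.\<close>

lemma linf_embedding_completely_isometric:
  "operator_matrix_norms n (\<lambda>i j. linf_embedding e (F i j)) = linf_matrix_norms n F"
  using linf_embedding_completely_contractive[of n F]
    linf_expectation_completely_contractive[of n "\<lambda>i j. linf_embedding e (F i j)"]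
  by (simp add: linf_embedding_bounded_operators linf_expectation_embedding)

text \<open>The norm of \<open>linf\<close> is defined independently of the matrix norms, so the
  same argument is carried out for it through 1-by-1 matrices.\<close>

lemma norm_linf_embedding: "norm (linf_embedding e F) = norm F"
proof (rule antisym)
  have [simp]: "{..<Suc 0} = {0}" by auto
  have "operator_matrix_norms 1 (\<lambda>i j. linf_embedding e F) \<le> norm F"
    unfolding linf_embedding_def
    by (rule operator_matrix_norms_diagonal_le[OF e, where d = "\<lambda>_ _. cell_average F"])
      (auto simp: norm_mult norm_cell_average_le mult_right_mono intro: exI[of _ "norm F"])
  then show "norm (linf_embedding e F) \<le> norm F" by (simp only: operator_matrix_norms_1)
  show "norm F \<le> norm (linf_embedding e F)"
    using norm_linf_expectation_le[of "linf_embedding e F"] by (simp add: linf_expectation_embedding)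
qed

lemma inj_linf_embedding: "inj (linf_embedding e)"
  by (metis injI linf_expectation_embedding)

lemma csubspace_range_linf_embedding: "csubspace (range (linf_embedding e))"
proof (rule complex_vector.subspaceI)
  have "linf_embedding e 0 = 0" using linf_embedding_add[of 0 0] by simp
  then show "0 \<in> range (linf_embedding e)" by (metis rangeI)
qed (auto simp flip: linf_embedding_add linf_embedding_scaleC)

lemma linear_projection_onto_range_linf_embedding:
  "linear_projection_onto bounded_operators (range (linf_embedding e))
    (linf_embedding e \<circ> linf_expectation e)"
  unfolding linear_projection_onto_def clinear_on_def
proof (intro conjI ballI allI)
  show "(linf_embedding e \<circ> linf_expectation e) ` bounded_operators = range (linf_embedding e)"
  proof (intro equalityI subsetI)
    fix S assume "S \<in> range (linf_embedding e)"
    then obtain F where "S = (linf_embedding e \<circ> linf_expectation e) (linf_embedding e F)"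
      by (auto simp: linf_expectation_embedding)
    then show "S \<in> (linf_embedding e \<circ> linf_expectation e) ` bounded_operators"
      using linf_embedding_bounded_operators by blast
  qed auto
qed (simp_all add: linf_expectation_add linf_expectation_scaleC linf_embedding_add
    linf_embedding_scaleC linf_expectation_embedding)

lemma completely_one_complemented_range_linf_embedding:
  "completely_one_complemented bounded_operators operator_matrix_norms (range (linf_embedding e))"
  unfolding completely_one_complemented_def completely_contractive_def
proof (intro conjI exI allI impI)
  fix n and T :: "nat \<Rightarrow> nat \<Rightarrow> 'h \<Rightarrow>\<^sub>L 'h"
  assume "\<forall>i<n. \<forall>j<n. T i j \<in> bounded_operators"
  then show "operator_matrix_norms n (\<lambda>i j. (linf_embedding e \<circ> linf_expectation e) (T i j))
      \<le> operator_matrix_norms n T"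
    by (simp add: linf_embedding_completely_isometric linf_expectation_completely_contractive)
qed (use csubspace_range_linf_embedding linf_embedding_bounded_operators
    linear_projection_onto_range_linf_embedding in \<open>auto simp: comp_def\<close>)

lemma one_complemented_range_linf_embedding:
  "one_complemented bounded_operators (range (linf_embedding e))"
  unfolding one_complemented_def has_op_norm_on_def
proof (intro conjI exI allI ballI impI)
  show "norm ((linf_embedding e \<circ> linf_expectation e) T) \<le> 1 * norm T" for T
    by (simp add: norm_linf_embedding norm_linf_expectation_le)
  fix K :: real
  assume "\<forall>T\<in>bounded_operators. norm ((linf_embedding e \<circ> linf_expectation e) T) \<le> K * norm T"
  \<comment> \<open>The image of a unit vector is fixed by the projection and forces its norm up to
    1.\<close>
  moreover obtain F :: linf where "norm F = 1" using ex_norm_1_linf by blast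
  ultimately show "1 \<le> K"
    using linf_embedding_bounded_operators[of F]
    by (auto simp: norm_linf_embedding linf_expectation_embedding dest!: bspec)
qed (use csubspace_range_linf_embedding linf_embedding_bounded_operators
    linear_projection_onto_range_linf_embedding in \<open>auto simp: comp_def\<close>)

lemma completely_isometrically_isomorphic_range_linf_embedding:
  "completely_isometrically_isomorphic (UNIV :: linf set) linf_matrix_norms
    (range (linf_embedding e)) operator_matrix_norms"
  unfolding completely_isometrically_isomorphic_def clinear_on_def complete_isometry_def
  by (intro exI[of _ "linf_embedding e"])
    (simp add: linf_embedding_add linf_embedding_scaleC linf_embedding_completely_isometric
      inj_linf_embedding inj_on_imp_bij_betw)

end

text \<open>The centres are required to lie in the range, so balls can be pulled back along
  \<open>u\<close>. By contraposition, failure of the property passes from \<open>linf\<close> to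
  its copy.\<close>

lemma ball_covering_property_isometry:
  fixes u :: "'a::real_normed_vector \<Rightarrow> 'b::real_normed_vector"
  assumes add: "\<And>x y. u (x + y) = u x + u y" and norm: "\<And>x. norm (u x) = norm x"
    and "ball_covering_property (range u)"
  shows "ball_covering_property (UNIV :: 'a set)"
proof -
  have diff: "u (x - y) = u x - u y" for x y
    using add[of "x - y" y] by simp
  obtain \<B> :: "('b \<times> real) set" where countable: "countable \<B>"
    and range: "\<forall>(c, r)\<in>\<B>. c \<in> range u \<and> 0 < r \<and> 0 \<notin> cball c r"
    and cover: "range u \<inter> sphere 0 1 \<subseteq> (\<Union>(c, r)\<in>\<B>. cball c r)"
    using assms(3) unfolding ball_covering_property_def by (elim exE conjE)
  define \<B>' where "\<B>' = {(c, r). (u c, r) \<in> \<B>}"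
  have inj: "inj u"
  proof (rule injI)
    fix x y assume "u x = u y"
    with diff[of x y] norm[of "x - y"] show "x = y" by simp
  qed
  \<comment> \<open>Injectivity of \<open>u\<close> keeps the pulled-back family countable.\<close>
  have "(\<lambda>(c, r). (u c, r)) ` \<B>' \<subseteq> \<B>" by (auto simp: \<B>'_def)
  then have "countable ((\<lambda>(c, r). (u c, r)) ` \<B>')"
    using countable by (rule countable_subset)
  moreover have "inj_on (\<lambda>(c, r). (u c, r)) \<B>'"
    using inj by (auto simp: inj_on_def)
  ultimately have "countable \<B>'"
    by (rule countable_image_inj_on)
  moreover have "\<forall>(c, r)\<in>\<B>'. c \<in> UNIV \<and> 0 < r \<and> 0 \<notin> cball c r"
  proof clarify
    fix c r assume "(c, r) \<in> \<B>'"
    then have "(u c, r) \<in> \<B>" by (simp add: \<B>'_def)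
    from bspec[OF range this] show "c \<in> UNIV \<and> 0 < r \<and> 0 \<notin> cball c r"
      using norm by (simp add: dist_norm)
  qed
  moreover have "UNIV \<inter> sphere 0 1 \<subseteq> (\<Union>(c, r)\<in>\<B>'. cball c r)"
  proof
    fix x :: 'a assume "x \<in> UNIV \<inter> sphere 0 1"
    then have "u x \<in> range u \<inter> sphere 0 1" using norm by simp
    with cover have "u x \<in> (\<Union>(c, r)\<in>\<B>. cball c r)" by (rule subsetD)
    then obtain c' r where c': "(c', r) \<in> \<B>" "u x \<in> cball c' r" by auto
    from bspec[OF range c'(1)] obtain c where c: "c' = u c" by auto
    have "norm (c - x) \<le> r" using c' norm[of "c - x"] by (simp add: c dist_norm diff)
    with c' show "x \<in> (\<Union>(c, r)\<in>\<B>'. cball c r)"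
      by (intro UN_I[of "(c, r)"]) (auto simp: \<B>'_def c dist_norm)
  qed
  ultimately show ?thesis unfolding ball_covering_property_def by blast
qed

theorem mainTheorem7:
  assumes infinite_dimensional: "\<not> (\<exists>B :: 'h::complex_hilbert set. finite B \<and> cspan B = UNIV)"
    and separable: "separable_space (euclidean :: 'h topology)"
  shows "ball_covering_property (bounded_operators :: ('h \<Rightarrow>\<^sub>L 'h) set) \<and>
    \<not> ball_covering_property (UNIV :: linf set) \<and>
    (\<exists>Y :: ('h \<Rightarrow>\<^sub>L 'h) set.
       completely_one_complemented bounded_operators operator_matrix_norms Y \<and>
       completely_isometrically_isomorphic (UNIV :: linf set) linf_matrix_norms
         Y operator_matrix_norms) \<and>
    (\<exists>Y :: ('h \<Rightarrow>\<^sub>L 'h) set.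
       one_complemented bounded_operators Y \<and>
       completely_one_complemented bounded_operators operator_matrix_norms Y \<and>
       \<not> ball_covering_property Y)"
proof -
  obtain e :: "nat \<Rightarrow> 'h" where e: "orthonormal e"
    using orthonormal_sequence_exists[OF infinite_dimensional] .
  \<comment> \<open>The range of the embedding serves as witness for both existential
    claims.\<close>
  have "\<not> ball_covering_property (range (linf_embedding e))"
    using ball_covering_property_isometry[of "linf_embedding e"] not_ball_covering_property_linf
    by (auto simp: linf_embedding_add[OF e] norm_linf_embedding[OF e])
  then show ?thesis
    using ball_covering_property_bounded_operators[OF separable] not_ball_covering_property_linf
      completely_one_complemented_range_linf_embedding[OF e]
      one_complemented_range_linf_embedding[OF e]
      completely_isometrically_isomorphic_range_linf_embedding[OF e]
    by blast
qed

end
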